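(* Let $a, b$ be finitary permutations of $\mathbb{N}$. If $f \in \operatorname{Perm}$ then $afb \in \operatorname{Perm}$. If $f \in \operatorname{Perm}_{\mathrm{CF}}$ then $afb \in \operatorname{Perm}_{\mathrm{CF}}$. Moreover, given (a program for) $f \in \operatorname{Perm}_{\mathrm{CF}}$, a decider for its cycle relation and a decider for its cycle finiteness problem, as well as $\eta$-indices for $a$ and $b$, one can compute a decider for the cycle relation and a decider for the cycle finiteness problem of $afb$.
   Context: $\mathcal{G}$ is the group of recursive permutations of $\mathbb{N}$; $[x]_f=\{f^k(x):k\in\mathbb{Z}\}$ and $x\equiv_f x'$ means $x'\in[x]_f$. $\operatorname{Perm}$ is the set of $f\in\mathcal{G}$ with $\equiv_f$ decidable; the cycle finiteness problem of $f$ is $\mathrm{CF}(f)=\{x : |[x]_f|<\infty\}$, and $\operatorname{Perm}_{\mathrm{CF}}$ is the set of $f\in\operatorname{Perm}$ with $\mathrm{CF}(f)$ decidable. A permutation is finitary if it moves only finitely many points. For $x,y$, $(x\,y)$ denotes the transposition of $x,y$ (the identity if $x=y$). An $\eta$-index for a finitary permutation $a$ is a code $z = \langle n, \langle \langle x_1,y_1\rangle, \dots, \langle x_n,y_n\rangle\rangle\rangle$ of a finite list of pairs with $a = (x_1\,y_1)\cdots(x_n\,y_n)$, where $\langle\cdots\rangle$ are recursive tuple codings. *)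

theory Defs
  imports Main "HOL-Library.Nat_Bijection" "HOL-Combinatorics.Transposition"
begin

datatype recf =
    Zero
  | Succ
  | Proj nat
  | Comp recf "recf list"
  | PrimRec recf recf
  | Mu recf

text \<open>\<open>recf_eval p xs y\<close>: the program \<open>p\<close> halts on input \<open>xs\<close> with output \<open>y\<close>. Programs carry no
  arity annotation; each one computes a partial recursive function of \<open>k\<close> arguments for every \<open>k\<close>,
  and is simply undefined where it meets an argument list that is too short.\<close>

inductive recf_eval :: "recf \<Rightarrow> nat list \<Rightarrow> nat \<Rightarrow> bool" where
  Zero: "recf_eval Zero xs 0"
| Succ: "recf_eval Succ (x # xs) (Suc x)"
| Proj: "i < length xs \<Longrightarrow> recf_eval (Proj i) xs (xs ! i)"
| Comp: "list_all2 (\<lambda>g y. recf_eval g xs y) gs ys \<Longrightarrow> recf_eval f ys z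
         \<Longrightarrow> recf_eval (Comp f gs) xs z"
| PrimRec_0: "recf_eval f xs y \<Longrightarrow> recf_eval (PrimRec f g) (0 # xs) y"
| PrimRec_Suc: "recf_eval (PrimRec f g) (n # xs) r \<Longrightarrow> recf_eval g (n # r # xs) y
         \<Longrightarrow> recf_eval (PrimRec f g) (Suc n # xs) y"
| Mu: "recf_eval f (n # xs) 0 \<Longrightarrow> (\<And>m. m < n \<Longrightarrow> \<exists>v. recf_eval f (m # xs) (Suc v))
         \<Longrightarrow> recf_eval (Mu f) xs n"

primrec recf_code :: "recf \<Rightarrow> nat" where
  "recf_code Zero = prod_encode (0, 0)"
| "recf_code Succ = prod_encode (1, 0)"
| "recf_code (Proj i) = prod_encode (2, i)"
| "recf_code (Comp f gs) =
     prod_encode (3, prod_encode (recf_code f, list_encode (map recf_code gs)))"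
| "recf_code (PrimRec f g) = prod_encode (4, prod_encode (recf_code f, recf_code g))"
| "recf_code (Mu f) = prod_encode (5, recf_code f)"

inductive_cases recf_eval_cases:
  "recf_eval Zero xs z"
  "recf_eval Succ xs z"
  "recf_eval (Proj i) xs z"
  "recf_eval (Comp f gs) xs z"
  "recf_eval (PrimRec f g) xs z"
  "recf_eval (Mu f) xs z"

lemma recf_eval_deterministic:
  "recf_eval p xs y \<Longrightarrow> recf_eval p xs z \<Longrightarrow> y = z"
proof (induction arbitrary: z rule: recf_eval.induct)
  case (Zero xs)
  then show ?case by (rule recf_eval_cases(1)) simp
next
  case (Succ x xs)
  then show ?case by (rule recf_eval_cases(2)) simp
next
  case (Proj i xs)
  from Proj.prems show ?case by (rule recf_eval_cases(3)) simp
next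
  case (Comp xs gs ys f z z')
  from Comp.prems obtain ys' where
    ys': "list_all2 (\<lambda>g y. recf_eval g xs y) gs ys'" and z': "recf_eval f ys' z'"
    by (rule recf_eval_cases(4))
  have "ys = ys'"
    using Comp.IH(1) ys' by (auto simp: list_all2_conv_all_nth intro!: nth_equalityI)
  with Comp.IH(2) z' show ?case by simp
next
  case (PrimRec_0 f xs y g)
  from PrimRec_0.prems have "recf_eval f xs z" by (rule recf_eval_cases(5)) simp_all
  then show ?case by (rule PrimRec_0.IH)
next
  case (PrimRec_Suc f g n xs r y)
  from PrimRec_Suc.prems obtain r' where
    r': "recf_eval (PrimRec f g) (n # xs) r'" "recf_eval g (n # r' # xs) z"
    by (rule recf_eval_cases(5)) simp_all
  with PrimRec_Suc.IH(1) have "r = r'" by blast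
  with PrimRec_Suc.IH(2) r'(2) show ?case by blast
next
  case (Mu f n xs)
  from Mu.prems have z: "recf_eval f (z # xs) 0" "\<And>m. m < z \<Longrightarrow> \<exists>v. recf_eval f (m # xs) (Suc v)"
    by (rule recf_eval_cases(6), blast)+
  show ?case
  proof (rule linorder_cases[of n z])
    assume "n < z" then show ?thesis using z(2) Mu.IH(1) by blast
  next
    assume "z < n" then show ?thesis using z(1) Mu.IH(2) by blast
  qed
qed

lemma recf_code_inject: "recf_code p = recf_code q \<longleftrightarrow> p = q"
proof
  show "recf_code p = recf_code q \<Longrightarrow> p = q"
  proof (induction p arbitrary: q)
    case (Comp f gs)
    then obtain f' gs' where q: "q = Comp f' gs'" "recf_code f = recf_code f'"
        "map recf_code gs = map recf_code gs'"
      by (cases q) (auto simp: list_encode_eq)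
    moreover have "gs = gs'"
    proof (rule nth_equalityI)
      show len: "length gs = length gs'" using q(3) by (rule map_eq_imp_length_eq)
      fix i assume i: "i < length gs"
      then have "recf_code (gs ! i) = recf_code (gs' ! i)" using q(3) len by (metis nth_map)
      then show "gs ! i = gs' ! i" using Comp.IH(2) i by simp
    qed
    ultimately show ?case using Comp.IH(1) by simp
  next
    case Zero then show ?case by (cases q) auto
  next
    case Succ then show ?case by (cases q) auto
  next
    case (Proj i) then show ?case by (cases q) auto
  next
    case (PrimRec f g) then show ?case by (cases q) auto
  next
    case (Mu f) then show ?case by (cases q) auto
  qed
qed simp

definition program_for :: "recf \<Rightarrow> (nat \<Rightarrow> nat) \<Rightarrow> bool" where
  "program_for p f \<longleftrightarrow> (\<forall>x. recf_eval p [x] (f x))"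

definition rel_decider :: "recf \<Rightarrow> (nat \<Rightarrow> nat \<Rightarrow> bool) \<Rightarrow> bool" where
  "rel_decider p R \<longleftrightarrow> (\<forall>x y. recf_eval p [x, y] (if R x y then 1 else 0))"

definition set_decider :: "recf \<Rightarrow> nat set \<Rightarrow> bool" where
  "set_decider p A \<longleftrightarrow> (\<forall>x. recf_eval p [x] (if x \<in> A then 1 else 0))"

definition rec_perms :: "(nat \<Rightarrow> nat) set" where
  "rec_perms = {f. bij f \<and> (\<exists>p. program_for p f)}"

definition perm_power :: "('a \<Rightarrow> 'a) \<Rightarrow> int \<Rightarrow> 'a \<Rightarrow> 'a" where
  "perm_power f k = (if k \<ge> 0 then f ^^ nat k else (inv f) ^^ nat (- k))"

definition cycle_of :: "('a \<Rightarrow> 'a) \<Rightarrow> 'a \<Rightarrow> 'a set" where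
  "cycle_of f x = {perm_power f k x | k. True}"

definition cycle_rel :: "('a \<Rightarrow> 'a) \<Rightarrow> 'a \<Rightarrow> 'a \<Rightarrow> bool" where
  "cycle_rel f x x' \<longleftrightarrow> x' \<in> cycle_of f x"

definition CF :: "('a \<Rightarrow> 'a) \<Rightarrow> 'a set" where
  "CF f = {x. finite (cycle_of f x)}"

definition Perm :: "(nat \<Rightarrow> nat) set" where
  "Perm = {f \<in> rec_perms. \<exists>p. rel_decider p (cycle_rel f)}"

definition Perm_CF :: "(nat \<Rightarrow> nat) set" where
  "Perm_CF = {f \<in> Perm. \<exists>p. set_decider p (CF f)}"

definition finitary :: "('a \<Rightarrow> 'a) \<Rightarrow> bool" where
  "finitary a \<longleftrightarrow> bij a \<and> finite {x. a x \<noteq> x}"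

text \<open>Products of permutations are compositions, so the rightmost factor acts first.\<close>

definition transpositions :: "('a \<times> 'a) list \<Rightarrow> 'a \<Rightarrow> 'a" where
  "transpositions ps = foldr (\<lambda>(x, y) g. Transposition.transpose x y \<circ> g) ps id"

definition eta_index :: "nat \<Rightarrow> (nat \<Rightarrow> nat) \<Rightarrow> bool" where
  "eta_index z a \<longleftrightarrow>
     (\<exists>ps. z = prod_encode (length ps, list_encode (map prod_encode ps)) \<and> a = transpositions ps)"

end

theory Submission
  imports Defs "HOL-Combinatorics.Permutations"
begin

text \<open>
Both factors are products of transpositions, and \<open>f \<circ> (x y) = (f x  f y) \<circ> f\<close>, so everything reduces
to \<open>g = (x y) \<circ> f\<close>. The cycles of \<open>f\<close> and \<open>g\<close> outside of \<open>U = [x]\<^sub>f \<union> [y]\<^sub>f\<close> are the same, and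
\<open>U = [x]\<^sub>g \<union> [y]\<^sub>g\<close>. Hence the cycle relation of \<open>g\<close> is known on \<open>U\<close> once the single bit
\<open>x \<equiv>\<^sub>g y\<close> is: if it is false, then iterating \<open>g\<close> on \<open>x\<close>, \<open>y\<close> and \<open>z\<close> eventually reveals on which of
the two cycles a point \<open>z\<close> of \<open>U\<close> lies. For \<open>x \<noteq> y\<close>, this bit is true iff \<open>x\<close> and \<open>y\<close> lie on
different cycles of \<open>f\<close>, at least one of them finite; it is computable from CF, and in the absence of a
decider for CF it can be chosen nonuniformly. If one infinite cycle is split, exactly one of the
parts is finite, and iterating \<open>g\<close> on \<open>x\<close> and \<open>y\<close> shows which.

The deciders for \<open>g\<close> arise from those for \<open>f\<close> by plugging the latter into a fixed template, so that
their codes are computed by arithmetic on codes, and the transpositions listed in the two indices are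
processed by primitive recursion.
\<close>

section \<open>Recursive functions and codable templates\<close>

lemma recf_eval_Comp1:
  "recf_eval g xs y \<Longrightarrow> recf_eval f [y] z \<Longrightarrow> recf_eval (Comp f [g]) xs z"
  by (rule recf_eval.Comp[of xs "[g]" "[y]"]) simp_all

lemma recf_eval_Comp2:
  "recf_eval g xs y \<Longrightarrow> recf_eval h xs w \<Longrightarrow> recf_eval f [y, w] z
    \<Longrightarrow> recf_eval (Comp f [g, h]) xs z"
  by (rule recf_eval.Comp[of xs "[g, h]" "[y, w]"]) simp_all

lemma recf_eval_Comp_map:
  "(\<And>g. g \<in> set gs \<Longrightarrow> recf_eval (p g) xs (F g)) \<Longrightarrow> recf_eval f (map F gs) z
    \<Longrightarrow> recf_eval (Comp f (map p gs)) xs z"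
  by (rule recf_eval.Comp[of xs _ "map F gs"]) (auto simp: list_all2_conv_all_nth)

lemma recf_eval_Proj: "i < length xs \<Longrightarrow> y = xs ! i \<Longrightarrow> recf_eval (Proj i) xs y"
  by (simp add: recf_eval.Proj)

section \<open>Programs for the pairing function and for constants\<close>

definition recf_add :: recf where
  "recf_add = PrimRec (Proj 0) (Comp Succ [Proj 1])"

definition recf_triangle :: recf where
  "recf_triangle = PrimRec Zero (Comp recf_add [Comp Succ [Proj 0], Proj 1])"

definition recf_pair :: recf where
  "recf_pair = Comp recf_add [Comp recf_triangle [recf_add], Proj 0]"

lemma recf_eval_add: "recf_eval recf_add [m, n] (m + n)"
  unfolding recf_add_def
proof (induction m)
  case 0
  show ?case by (auto intro!: recf_eval.PrimRec_0 recf_eval_Proj)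
next
  case (Suc m)
  show ?case
    by (rule recf_eval.PrimRec_Suc[OF Suc], rule recf_eval_Comp1[where y = "m + n"])
      (auto intro: recf_eval_Proj recf_eval.Succ)
qed

lemma recf_eval_triangle: "recf_eval recf_triangle [n] (triangle n)"
  unfolding recf_triangle_def
proof (induction n)
  case 0
  show ?case by (auto intro!: recf_eval.PrimRec_0 recf_eval.Zero)
next
  case (Suc n)
  have "recf_eval recf_add [Suc n, triangle n] (triangle (Suc n))"
    using recf_eval_add[of "Suc n" "triangle n"] by (simp add: ac_simps)
  then show ?case
    by (intro recf_eval.PrimRec_Suc[OF Suc] recf_eval_Comp2[where y = "Suc n" and w = "triangle n"]
        recf_eval_Comp1[where y = n]) (auto intro: recf_eval_Proj recf_eval.Succ)
qed

lemma recf_eval_pair: "recf_eval recf_pair [m, n] (prod_encode (m, n))"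
  unfolding recf_pair_def prod_encode_def
  by (auto intro!: recf_eval_Comp2 recf_eval_Comp1 recf_eval_add recf_eval_triangle recf_eval_Proj)

text \<open>These programs accept argument lists of every length. They allow a number to be plugged
  into a template in the shape of a program.\<close>

primrec recf_const :: "nat \<Rightarrow> recf" where
  "recf_const 0 = Zero"
| "recf_const (Suc n) = Comp Succ [recf_const n]"

lemma recf_eval_const: "recf_eval (recf_const n) xs n"
  by (induction n) (auto intro: recf_eval.Zero recf_eval.Succ recf_eval_Comp1)

definition total_recursive :: "nat \<Rightarrow> (nat list \<Rightarrow> nat) \<Rightarrow> bool" where
  "total_recursive k F \<longleftrightarrow> (\<exists>p. \<forall>xs. length xs = k \<longrightarrow> recf_eval p xs (F xs))"

lemma total_recursive_const: "total_recursive k (\<lambda>xs. c)"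
  unfolding total_recursive_def using recf_eval_const by blast

lemma total_recursive_nth: "i < k \<Longrightarrow> total_recursive k (\<lambda>xs. xs ! i)"
  unfolding total_recursive_def by (metis recf_eval.Proj)

lemma total_recursive_prod_encode:
  "total_recursive k F \<Longrightarrow> total_recursive k G
    \<Longrightarrow> total_recursive k (\<lambda>xs. prod_encode (F xs, G xs))"
  unfolding total_recursive_def by (meson recf_eval_Comp2 recf_eval_pair)

lemma total_recursive_Suc:
  "total_recursive k F \<Longrightarrow> total_recursive k (\<lambda>xs. Suc (F xs))"
  unfolding total_recursive_def by (meson recf_eval_Comp1 recf_eval.Succ)

lemma total_recursive_list_encode:
  "(\<And>g. g \<in> set gs \<Longrightarrow> total_recursive k (F g))
    \<Longrightarrow> total_recursive k (\<lambda>xs. list_encode (map (\<lambda>g. F g xs) gs))"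
  by (induction gs)
    (simp_all add: total_recursive_const total_recursive_Suc total_recursive_prod_encode)

text \<open>A template maps \<open>n\<close> given programs to a new one. It is codable if this map is recursive
  on codes; no universal program is needed, since templates only plug programs together.\<close>

definition codable :: "nat \<Rightarrow> (recf list \<Rightarrow> recf) \<Rightarrow> bool" where
  "codable n T \<longleftrightarrow> (\<exists>F. total_recursive n F
     \<and> (\<forall>ps. length ps = n \<longrightarrow> F (map recf_code ps) = recf_code (T ps)))"

lemma codable_const: "codable n (\<lambda>ps. p)"
  unfolding codable_def using total_recursive_const by metis

lemma codable_nth: "i < n \<Longrightarrow> codable n (\<lambda>ps. ps ! i)"
  unfolding codable_def
  by (rule exI[of _ "\<lambda>xs. xs ! i"]) (simp add: total_recursive_nth)

lemma codable_PrimRec: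
  assumes "codable n S" "codable n T"
  shows "codable n (\<lambda>ps. PrimRec (S ps) (T ps))"
proof -
  obtain F G where "total_recursive n F" "total_recursive n G"
    "\<forall>ps. length ps = n \<longrightarrow> F (map recf_code ps) = recf_code (S ps)"
    "\<forall>ps. length ps = n \<longrightarrow> G (map recf_code ps) = recf_code (T ps)"
    using assms unfolding codable_def by blast
  then show ?thesis unfolding codable_def
    by (intro exI[of _ "\<lambda>xs. prod_encode (4, prod_encode (F xs, G xs))"])
      (simp add: total_recursive_prod_encode total_recursive_const)
qed

lemma codable_Mu:
  assumes "codable n S"
  shows "codable n (\<lambda>ps. Mu (S ps))"
proof -
  obtain F where "total_recursive n F"
    "\<forall>ps. length ps = n \<longrightarrow> F (map recf_code ps) = recf_code (S ps)"
    using assms unfolding codable_def by blast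
  then show ?thesis unfolding codable_def
    by (intro exI[of _ "\<lambda>xs. prod_encode (5, F xs)"])
      (simp add: total_recursive_prod_encode total_recursive_const)
qed

lemma codable_Comp:
  assumes "codable n S" "\<And>g. g \<in> set gs \<Longrightarrow> codable n (T g)"
  shows "codable n (\<lambda>ps. Comp (S ps) (map (\<lambda>g. T g ps) gs))"
proof -
  obtain F where F: "total_recursive n F"
    "\<forall>ps. length ps = n \<longrightarrow> F (map recf_code ps) = recf_code (S ps)"
    using assms(1) unfolding codable_def by blast
  obtain G where G: "g \<in> set gs \<Longrightarrow> total_recursive n (G g)"
    "g \<in> set gs \<Longrightarrow> length ps = n \<Longrightarrow> G g (map recf_code ps) = recf_code (T g ps)" for g ps
    using assms(2) unfolding codable_def by metis
  have "map (\<lambda>g. G g (map recf_code ps)) gs = map recf_code (map (\<lambda>g. T g ps) gs)"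
    if "length ps = n" for ps
    using G(2) that by simp
  then have "list_encode (map (\<lambda>g. G g (map recf_code ps)) gs)
      = list_encode (map recf_code (map (\<lambda>g. T g ps) gs))" if "length ps = n" for ps
    using that by presburger
  with F G(1) show ?thesis unfolding codable_def
    by (intro exI[of _ "\<lambda>xs. prod_encode (3, prod_encode (F xs,
          list_encode (map (\<lambda>g. G g xs) gs)))"])
      (simp add: total_recursive_prod_encode total_recursive_const total_recursive_list_encode)
qed

text \<open>\<open>V\<close> pairs lists of programs with the data they stand for; a single template has to work
  for all these pairs.\<close>

definition computable ::
  "nat \<Rightarrow> (recf list \<times> 'a) set \<Rightarrow> nat \<Rightarrow> (recf list \<times> 'a \<Rightarrow> nat list \<Rightarrow> nat) \<Rightarrow> bool" where
  "computable n V k F \<longleftrightarrow> (\<exists>T. codable n T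
     \<and> (\<forall>i \<in> V. \<forall>xs. length xs = k \<longrightarrow> recf_eval (T (fst i)) xs (F i xs)))"

section \<open>Closure properties of computability relative to given programs\<close>

lemma computableE:
  assumes "computable n V k F"
  obtains T where "codable n T"
    "\<And>i xs. i \<in> V \<Longrightarrow> length xs = k \<Longrightarrow> recf_eval (T (fst i)) xs (F i xs)"
  using assms unfolding computable_def by blast

lemma computable_total_recursive:
  "total_recursive k F \<Longrightarrow> computable n V k (\<lambda>i. F)"
  unfolding computable_def total_recursive_def using codable_const by blast

text \<open>Any member of \<open>V\<close> instantiates the template and yields a program. The dummy
  parameter of \<open>recursive\<close> serves as such a member in the main proof.\<close>

lemma total_recursive_computable:
  fixes V :: "(recf list \<times> 'a) set"
  assumes "computable n V k (\<lambda>i. F)" "V \<noteq> {}"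
  shows "total_recursive k F"
  using assms unfolding computable_def total_recursive_def by blast

lemma computable_const: "computable n V k (\<lambda>i xs. c)"
  by (rule computable_total_recursive) (rule total_recursive_const)

lemma computable_nth: "j < k \<Longrightarrow> computable n V k (\<lambda>i xs. xs ! j)"
  by (rule computable_total_recursive) (rule total_recursive_nth)

lemma computable_cong:
  assumes "computable n V k F" "\<And>i xs. i \<in> V \<Longrightarrow> length xs = k \<Longrightarrow> F i xs = G i xs"
  shows "computable n V k G"
  using assms unfolding computable_def by auto

text \<open>In the step of \<open>computable_rec_nat\<close> the original arguments stand behind the
  counter and the previous value, so they are addressed through \<open>drop 2\<close>.\<close>

lemma computable_drop_nth: "m + j < k \<Longrightarrow> computable n V k (\<lambda>i xs. drop m xs ! j)"
  by (rule computable_cong[OF computable_nth[of "m + j"]]) simp_all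

lemma computable_Suc_nth: "Suc j < k \<Longrightarrow> computable n V k (\<lambda>i xs. tl xs ! j)"
  by (rule computable_cong[OF computable_nth[of "Suc j"]]) (simp_all add: nth_tl)

lemma computable_comp:
  assumes "computable n V m F" "\<And>G. G \<in> set Gs \<Longrightarrow> computable n V k G" "length Gs = m"
  shows "computable n V k (\<lambda>i xs. F i (map (\<lambda>G. G i xs) Gs))"
proof -
  obtain S where S: "codable n S"
    "\<And>i xs. i \<in> V \<Longrightarrow> length xs = m \<Longrightarrow> recf_eval (S (fst i)) xs (F i xs)"
    using assms(1) by (rule computableE) blast
  obtain T where T: "G \<in> set Gs \<Longrightarrow> codable n (T G)"
    "G \<in> set Gs \<Longrightarrow> i \<in> V \<Longrightarrow> length xs = k \<Longrightarrow> recf_eval (T G (fst i)) xs (G i xs)" for G i xs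
    using assms(2) unfolding computable_def by metis
  have "codable n (\<lambda>ps. Comp (S ps) (map (\<lambda>G. T G ps) Gs))"
    using S(1) T(1) by (rule codable_Comp)
  moreover have "recf_eval (Comp (S (fst i)) (map (\<lambda>G. T G (fst i)) Gs)) xs
      (F i (map (\<lambda>G. G i xs) Gs))" if "i \<in> V" "length xs = k" for i xs
    using that T(2) S(2) assms(3) by (intro recf_eval_Comp_map[where F = "\<lambda>G. G i xs"]) auto
  ultimately show ?thesis unfolding computable_def by blast
qed

lemma computable_comp1:
  "computable n V 1 (\<lambda>i ys. F i (ys ! 0)) \<Longrightarrow> computable n V k G
    \<Longrightarrow> computable n V k (\<lambda>i xs. F i (G i xs))"
  using computable_comp[of n V 1 "\<lambda>i ys. F i (ys ! 0)" "[G]" k] by simp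

lemma computable_comp2:
  "computable n V 2 (\<lambda>i ys. F i (ys ! 0) (ys ! 1)) \<Longrightarrow> computable n V k G \<Longrightarrow> computable n V k H
    \<Longrightarrow> computable n V k (\<lambda>i xs. F i (G i xs) (H i xs))"
  using computable_comp[of n V 2 "\<lambda>i ys. F i (ys ! 0) (ys ! 1)" "[G, H]" k] by auto

lemma computable_Suc:
  "computable n V k F \<Longrightarrow> computable n V k (\<lambda>i xs. Suc (F i xs))"
  using computable_comp1[of n V "\<lambda>i. Suc", OF computable_total_recursive]
  by (metis One_nat_def less_one total_recursive_Suc total_recursive_nth)

lemma computable_prod_encode:
  assumes "computable n V k F" "computable n V k G"
  shows "computable n V k (\<lambda>i xs. prod_encode (F i xs, G i xs))"
  by (rule computable_comp2[of n V "\<lambda>i x y. prod_encode (x, y)"])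
    (auto intro!: computable_total_recursive total_recursive_prod_encode total_recursive_nth assms)

lemma computable_rec_nat:
  assumes N: "computable n V k N" and B: "computable n V k B"
    and S: "computable n V (Suc (Suc k)) (\<lambda>i ys. S i (ys ! 0) (ys ! 1) (drop 2 ys))"
  shows "computable n V k (\<lambda>i xs. rec_nat (B i xs) (\<lambda>m r. S i m r xs) (N i xs))"
proof -
  obtain TB where TB: "codable n TB"
    "\<And>i xs. i \<in> V \<Longrightarrow> length xs = k \<Longrightarrow> recf_eval (TB (fst i)) xs (B i xs)"
    using B by (rule computableE) blast
  obtain TS where TS: "codable n TS"
    "\<And>i ys. i \<in> V \<Longrightarrow> length ys = Suc (Suc k)
      \<Longrightarrow> recf_eval (TS (fst i)) ys (S i (ys ! 0) (ys ! 1) (drop 2 ys))"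
    using S by (rule computableE) blast
  have rec: "recf_eval (PrimRec (TB (fst i)) (TS (fst i))) (m # xs)
      (rec_nat (B i xs) (\<lambda>m r. S i m r xs) m)" if "i \<in> V" "length xs = k" for i m xs
  proof (induction m)
    case 0
    show ?case using TB(2)[OF that] by (simp add: recf_eval.PrimRec_0)
  next
    case (Suc m)
    show ?case
      using TS(2)[OF that(1), of "m # rec_nat (B i xs) (\<lambda>m r. S i m r xs) m # xs"] that(2)
      by (auto intro: recf_eval.PrimRec_Suc[OF Suc])
  qed
  \<comment> \<open>\<open>PrimRec\<close> recurses on its first argument. The counter is therefore
    first taken as an extra argument in front of \<open>xs\<close>; composition with
    \<open>N\<close> and the projections then removes it.\<close>
  have "computable n V (Suc k) (\<lambda>i ys. rec_nat (B i (tl ys)) (\<lambda>m r. S i m r (tl ys)) (ys ! 0))"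
    unfolding computable_def
  proof (intro exI conjI ballI allI impI)
    show "codable n (\<lambda>ps. PrimRec (TB ps) (TS ps))" using TB(1) TS(1) by (rule codable_PrimRec)
    fix i and ys :: "nat list" assume "i \<in> V" "length ys = Suc k"
    then show "recf_eval (PrimRec (TB (fst i)) (TS (fst i))) ys
        (rec_nat (B i (tl ys)) (\<lambda>m r. S i m r (tl ys)) (ys ! 0))"
      using rec[of i "tl ys" "hd ys"] by (cases ys) auto
  qed
  moreover have "computable n V k G" if "G \<in> set (N # map (\<lambda>j i xs. xs ! j) [0..<k])" for G
    using that N computable_nth by auto
  ultimately have "computable n V k (\<lambda>i xs. rec_nat
      (B i (tl (map (\<lambda>G. G i xs) (N # map (\<lambda>j i xs. xs ! j) [0..<k]))))
      (\<lambda>m r. S i m r (tl (map (\<lambda>G. G i xs) (N # map (\<lambda>j i xs. xs ! j) [0..<k]))))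
      (map (\<lambda>G. G i xs) (N # map (\<lambda>j i xs. xs ! j) [0..<k]) ! 0))"
    by (rule computable_comp) simp_all
  then show ?thesis by (rule computable_cong) (auto simp: comp_def map_nth)
qed

text \<open>A recursion on \<open>N\<close> whose step ignores counter and previous value returns
  \<open>F\<close> as soon as \<open>N\<close> is positive. Both branches are assumed total, so a
  search within one of them has to halt even where the condition selects the other.\<close>

lemma computable_if_nonzero:
  assumes "computable n V k N" "computable n V k F" "computable n V k G"
  shows "computable n V k (\<lambda>i xs. if N i xs = 0 then G i xs else F i xs)"
proof -
  have "computable n V (Suc (Suc k)) (\<lambda>i ys. F i (drop 2 ys))"
    using computable_comp[OF assms(2), of "map (\<lambda>j i ys. ys ! (j + 2)) [0..<k]" "Suc (Suc k)"]
    by (rule computable_cong) (auto simp: computable_nth comp_def intro!: arg_cong[of _ _ "F _"] nth_equalityI)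
  from computable_rec_nat[OF assms(1,3) this]
  show ?thesis by (rule computable_cong) (auto split: nat.split simp: gr0_conv_Suc)
qed


lemma computable_funpow:
  assumes "computable n V 1 (\<lambda>i ys. F i (ys ! 0))" "computable n V k N" "computable n V k G"
  shows "computable n V k (\<lambda>i xs. (F i ^^ N i xs) (G i xs))"
proof -
  have "computable n V (Suc (Suc k)) (\<lambda>i ys. F i (ys ! 1))"
    using assms(1) by (rule computable_comp1) (simp add: computable_nth)
  then have "computable n V k (\<lambda>i xs. rec_nat (G i xs) (\<lambda>m r. F i r) (N i xs))"
    by (rule computable_rec_nat[OF assms(2,3)])
  moreover have "rec_nat x (\<lambda>m. f) m = (f ^^ m) x" for f :: "nat \<Rightarrow> nat" and x m
    by (induction m) simp_all
  ultimately show ?thesis by simp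
qed

lemma computable_minus:
  assumes "computable n V k F" "computable n V k G"
  shows "computable n V k (\<lambda>i xs. F i xs - G i xs)"
proof -
  have pred: "computable n V k' (\<lambda>i xs. H i xs - 1)" if "computable n V k' H" for k' H
  proof (rule computable_cong)
    show "computable n V k' (\<lambda>i xs. rec_nat 0 (\<lambda>m r. m) (H i xs))"
      by (intro computable_rec_nat that computable_const computable_nth) simp
    show "rec_nat 0 (\<lambda>m r. m) (H i xs) = H i xs - 1" for i xs
      by (cases "H i xs") simp_all
  qed
  have "computable n V k (\<lambda>i xs. ((\<lambda>m. m - 1) ^^ G i xs) (F i xs))"
    by (intro computable_funpow assms pred computable_nth) simp
  moreover have "((\<lambda>m. m - 1) ^^ b) a = a - b" for a b :: nat
    by (induction b) simp_all
  ultimately show ?thesis by simp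
qed

section \<open>Decidable predicates, least search and decoding of pairs\<close>

definition decidable ::
  "nat \<Rightarrow> (recf list \<times> 'a) set \<Rightarrow> nat \<Rightarrow> (recf list \<times> 'a \<Rightarrow> nat list \<Rightarrow> bool) \<Rightarrow> bool" where
  "decidable n V k P \<longleftrightarrow> computable n V k (\<lambda>i xs. of_bool (P i xs))"

lemma computable_if:
  assumes "decidable n V k P" "computable n V k F" "computable n V k G"
  shows "computable n V k (\<lambda>i xs. if P i xs then F i xs else G i xs)"
  using computable_if_nonzero[OF assms(1)[unfolded decidable_def] assms(2,3)]
  by (rule computable_cong) simp

lemma decidable_not: "decidable n V k P \<Longrightarrow> decidable n V k (\<lambda>i xs. \<not> P i xs)"
  unfolding decidable_def
  by (rule computable_cong[OF computable_if[of n V k P "\<lambda>i xs. 0" "\<lambda>i xs. 1"]])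
    (auto simp: decidable_def computable_const)

lemma decidable_conj:
  "decidable n V k P \<Longrightarrow> decidable n V k Q \<Longrightarrow> decidable n V k (\<lambda>i xs. P i xs \<and> Q i xs)"
  by (unfold decidable_def,
      rule computable_cong[OF computable_if[of n V k P "\<lambda>i xs. of_bool (Q i xs)" "\<lambda>i xs. 0"]])
    (auto simp: decidable_def computable_const)

lemma decidable_disj:
  "decidable n V k P \<Longrightarrow> decidable n V k Q \<Longrightarrow> decidable n V k (\<lambda>i xs. P i xs \<or> Q i xs)"
  using decidable_not[OF decidable_conj[OF decidable_not decidable_not]] by force

lemma decidable_iff:
  "decidable n V k P \<Longrightarrow> decidable n V k Q \<Longrightarrow> decidable n V k (\<lambda>i xs. P i xs \<longleftrightarrow> Q i xs)"
proof -
  assume "decidable n V k P" "decidable n V k Q"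
  then have "decidable n V k (\<lambda>i xs. P i xs \<and> Q i xs \<or> \<not> P i xs \<and> \<not> Q i xs)"
    by (intro decidable_disj decidable_conj decidable_not)
  moreover have "(\<lambda>i xs. P i xs \<and> Q i xs \<or> \<not> P i xs \<and> \<not> Q i xs) = (\<lambda>i xs. P i xs \<longleftrightarrow> Q i xs)"
    by (intro ext) blast
  ultimately show ?thesis by simp
qed

lemma decidable_le:
  assumes "computable n V k F" "computable n V k G"
  shows "decidable n V k (\<lambda>i xs. F i xs \<le> G i xs)"
  using computable_if_nonzero[OF computable_minus[OF assms] computable_const[of n V k 0]
      computable_const[of n V k 1]]
  unfolding decidable_def by (rule computable_cong) simp

lemma decidable_less:
  assumes "computable n V k F" "computable n V k G"
  shows "decidable n V k (\<lambda>i xs. F i xs < G i xs)"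
  using decidable_not[OF decidable_le[OF assms(2,1)]] by (simp add: not_le)

lemma decidable_eq:
  assumes "computable n V k F" "computable n V k G"
  shows "decidable n V k (\<lambda>i xs. F i xs = G i xs)"
  using decidable_conj[OF decidable_le[OF assms] decidable_le[OF assms(2,1)]]
  by (simp add: order_eq_iff)

lemma decidable_comp1:
  "decidable n V 1 (\<lambda>i ys. P i (ys ! 0)) \<Longrightarrow> computable n V k G
    \<Longrightarrow> decidable n V k (\<lambda>i xs. P i (G i xs))"
  unfolding decidable_def by (rule computable_comp1)

lemma decidable_comp2:
  "decidable n V 2 (\<lambda>i ys. P i (ys ! 0) (ys ! 1)) \<Longrightarrow> computable n V k G \<Longrightarrow> computable n V k H
    \<Longrightarrow> decidable n V k (\<lambda>i xs. P i (G i xs) (H i xs))"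
  unfolding decidable_def by (rule computable_comp2)

lemma computable_Least:
  assumes P: "decidable n V (Suc k) (\<lambda>i ys. P i (ys ! 0) (tl ys))"
    and ex: "\<And>i xs. i \<in> V \<Longrightarrow> length xs = k \<Longrightarrow> \<exists>m. P i m xs"
  shows "computable n V k (\<lambda>i xs. LEAST m. P i m xs)"
proof -
  \<comment> \<open>\<open>Mu\<close> looks for the first zero, hence \<open>T\<close> decides the
    negation of \<open>P\<close>.\<close>
  obtain T where T: "codable n T"
    "\<And>i ys. i \<in> V \<Longrightarrow> length ys = Suc k
      \<Longrightarrow> recf_eval (T (fst i)) ys (of_bool (\<not> P i (ys ! 0) (tl ys)))"
    using decidable_not[OF P] unfolding decidable_def by (rule computableE) blast
  have "recf_eval (Mu (T (fst i))) xs (LEAST m. P i m xs)" if i: "i \<in> V" "length xs = k" for i xs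
  proof (rule recf_eval.Mu)
    have ev: "recf_eval (T (fst i)) (m # xs) (of_bool (\<not> P i m xs))" for m
      using T(2)[OF i(1), of "m # xs"] i(2) by simp
    show "recf_eval (T (fst i)) ((LEAST m. P i m xs) # xs) 0"
      using ev[of "LEAST m. P i m xs"] LeastI_ex[OF ex[OF i]] by simp
    fix m assume "m < (LEAST m. P i m xs)"
    then show "\<exists>v. recf_eval (T (fst i)) (m # xs) (Suc v)"
      using ev[of m] not_less_Least[of m "\<lambda>m. P i m xs"] by auto
  qed
  with codable_Mu[OF T(1)] show ?thesis unfolding computable_def by blast
qed

lemma computable_add:
  "computable n V k F \<Longrightarrow> computable n V k G \<Longrightarrow> computable n V k (\<lambda>i xs. F i xs + G i xs)"
proof -
  assume "computable n V k F" "computable n V k G"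
  then have "computable n V k (\<lambda>i xs. (Suc ^^ F i xs) (G i xs))"
    by (intro computable_funpow computable_Suc computable_nth) simp_all
  then show ?thesis by (simp add: funpow_add)
qed

lemma computable_triangle:
  assumes "computable n V k F" shows "computable n V k (\<lambda>i xs. triangle (F i xs))"
proof (rule computable_cong)
  show "computable n V k (\<lambda>i xs. rec_nat 0 (\<lambda>m r. r + Suc m) (F i xs))"
    by (intro computable_rec_nat computable_add computable_Suc computable_const computable_nth assms)
      simp_all
  have "rec_nat 0 (\<lambda>m r. r + Suc m) x = triangle x" for x
    by (induction x) simp_all
  then show "rec_nat 0 (\<lambda>m r. r + Suc m) (F i xs) = triangle (F i xs)" for i xs by simp
qed

lemma triangle_mono: "m \<le> n \<Longrightarrow> triangle m \<le> triangle n"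
  by (induction n) (auto simp: le_Suc_eq)

text \<open>\<open>prod_encode (a, b)\<close> is \<open>triangle (a + b) + a\<close>, which is at
  least \<open>triangle (a + b)\<close> and below \<open>triangle (Suc (a + b))\<close>. A least
  search thus recovers the sum \<open>a + b\<close>, and from it both components.\<close>

lemma prod_decode_Least:
  fixes z :: nat
  defines "s \<equiv> LEAST s. z < triangle (Suc s)"
  shows "prod_decode z = (z - triangle s, s - (z - triangle s))"
proof -
  obtain a b where ab: "prod_decode z = (a, b)" by fastforce
  then have "z = prod_encode (a, b)" by (metis prod_decode_inverse)
  then have z: "z = triangle (a + b) + a" by (simp add: prod_encode_def)
  have "s = a + b" unfolding s_def
  proof (rule Least_equality)
    show "z < triangle (Suc (a + b))" using z by simp
    fix r assume "z < triangle (Suc r)"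
    then have "\<not> triangle (Suc r) \<le> triangle (a + b)" using z by linarith
    then show "a + b \<le> r" using triangle_mono[of "Suc r" "a + b"] by linarith
  qed
  then show ?thesis using ab z by simp
qed

lemma computable_prod_decode:
  assumes "computable n V k F"
  shows "computable n V k (\<lambda>i xs. fst (prod_decode (F i xs)))"
    and "computable n V k (\<lambda>i xs. snd (prod_decode (F i xs)))"
proof -
  have ex: "\<exists>s. z < triangle (Suc s)" for z
    by (rule exI[of _ z]) simp
  have L: "computable n V 1 (\<lambda>i ys. LEAST s. ys ! 0 < triangle (Suc s))"
    by (intro computable_Least decidable_less computable_triangle computable_Suc computable_nth
        computable_Suc_nth ex) simp_all
  have 1: "computable n V 1 (\<lambda>i ys. fst (prod_decode (ys ! 0)))"
    unfolding prod_decode_Least fst_conv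
    by (intro computable_minus computable_triangle L computable_nth) simp
  have 2: "computable n V 1 (\<lambda>i ys. snd (prod_decode (ys ! 0)))"
    unfolding prod_decode_Least snd_conv
    by (intro computable_minus computable_triangle L computable_nth) simp
  show "computable n V k (\<lambda>i xs. fst (prod_decode (F i xs)))"
    by (rule computable_comp1[where F = "\<lambda>i x. fst (prod_decode x)", OF 1 assms])
  show "computable n V k (\<lambda>i xs. snd (prod_decode (F i xs)))"
    by (rule computable_comp1[where F = "\<lambda>i x. snd (prod_decode x)", OF 2 assms])
qed

section \<open>Multiplying a permutation by a transposition\<close>

text \<open>Trades integer exponents and inverses for forward iterates. This form is symmetric, and
  transitivity follows by adding exponents.\<close>

lemma cycle_rel_iff_funpow_eq:
  assumes "bij f"
  shows "cycle_rel f x y \<longleftrightarrow> (\<exists>m n. (f ^^ m) x = (f ^^ n) y)"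
proof -
  have inv: "(inv f ^^ m) u = v \<longleftrightarrow> u = (f ^^ m) v" for m u v
    using bij_inv_eq_iff[OF bij_fn[OF assms]] inv_fn[OF assms] by metis
  have inj: "inj (f ^^ m)" for m using bij_fn[OF assms] bij_is_inj by blast
  show ?thesis
  proof
    assume "cycle_rel f x y"
    then obtain k where "y = perm_power f k x" unfolding cycle_rel_def cycle_of_def by blast
    then have "(f ^^ nat k) x = y \<or> x = (f ^^ nat (- k)) y"
      using inv[of "nat (- k)" x y] unfolding perm_power_def by (auto split: if_splits)
    then show "\<exists>m n. (f ^^ m) x = (f ^^ n) y" by (metis funpow_0)
  next
    assume "\<exists>m n. (f ^^ m) x = (f ^^ n) y"
    then obtain m n where mn: "(f ^^ m) x = (f ^^ n) y" by blast
    \<comment> \<open>The common iterate is cancelled by injectivity, which leaves the difference of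
      the exponents.\<close>
    have "y = perm_power f (int m - int n) x"
    proof (cases "n \<le> m")
      case True
      then obtain d where d: "m = n + d" using le_iff_add by blast
      then have "(f ^^ d) x = y" using mn inj[of n] by (auto simp: funpow_add dest: injD)
      then show ?thesis using d by (simp add: perm_power_def)
    next
      case False
      then obtain d where d: "n = m + d" "d > 0" by (metis less_imp_add_positive not_le)
      then have "x = (f ^^ d) y" using mn inj[of m] by (auto simp: funpow_add dest: injD)
      then show ?thesis using d inv[of d "(f ^^ d) y" y] by (simp add: perm_power_def)
    qed
    then show "cycle_rel f x y" unfolding cycle_rel_def cycle_of_def by blast
  qed
qed

text \<open>Here one of the two points reaches the other by iterating \<open>f\<close>, a condition
  that can be searched for with a program for \<open>f\<close> alone.\<close>

lemma cycle_rel_iff_funpow: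
  assumes "bij f"
  shows "cycle_rel f x y \<longleftrightarrow> (\<exists>n. (f ^^ n) x = y \<or> (f ^^ n) y = x)"
proof
  assume "cycle_rel f x y"
  then obtain m n where mn: "(f ^^ m) x = (f ^^ n) y"
    using cycle_rel_iff_funpow_eq[OF assms] by blast
  have inj: "inj (f ^^ m)" for m using bij_fn[OF assms] bij_is_inj by blast
  show "\<exists>n. (f ^^ n) x = y \<or> (f ^^ n) y = x"
  proof (cases "n \<le> m")
    case True
    then obtain d where "m = n + d" using le_iff_add by blast
    then have "(f ^^ d) x = y" using mn inj[of n] by (auto simp: funpow_add dest: injD)
    then show ?thesis by blast
  next
    case False
    then obtain d where "n = m + d" by (metis le_iff_add nat_le_linear)
    then have "(f ^^ d) y = x" using mn inj[of m] by (auto simp: funpow_add dest: injD)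
    then show ?thesis by blast
  qed
next
  assume "\<exists>n. (f ^^ n) x = y \<or> (f ^^ n) y = x"
  then show "cycle_rel f x y" using cycle_rel_iff_funpow_eq[OF assms] by (metis funpow_0)
qed

lemma cycle_rel_refl: "bij f \<Longrightarrow> cycle_rel f x x"
  using cycle_rel_iff_funpow_eq by metis

lemma cycle_rel_sym: "bij f \<Longrightarrow> cycle_rel f x y \<Longrightarrow> cycle_rel f y x"
  using cycle_rel_iff_funpow_eq by metis

lemma cycle_rel_trans:
  assumes "bij f" "cycle_rel f x y" "cycle_rel f y z"
  shows "cycle_rel f x z"
proof -
  obtain m n p q where mn: "(f ^^ m) x = (f ^^ n) y" and pq: "(f ^^ p) y = (f ^^ q) z"
    using assms(2,3) unfolding cycle_rel_iff_funpow_eq[OF assms(1)] by blast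
  have "(f ^^ (p + m)) x = (f ^^ (p + n)) y" using mn by (simp add: funpow_add)
  also have "\<dots> = (f ^^ (n + q)) z" using pq by (simp add: funpow_add add.commute[of p])
  finally show ?thesis unfolding cycle_rel_iff_funpow_eq[OF assms(1)] by blast
qed

lemma cycle_rel_step: "bij f \<Longrightarrow> cycle_rel f x (f x)"
  using cycle_rel_iff_funpow[of f] by (metis funpow_0 funpow_Suc_right comp_apply)

lemma cycle_rel_least:
  assumes "bij f" "cycle_rel f x y"
    and "\<And>x. R x x" "\<And>x y. R x y \<Longrightarrow> R y x" "\<And>x y z. R x y \<Longrightarrow> R y z \<Longrightarrow> R x z"
    and "\<And>x. R x (f x)"
  shows "R x y"
proof -
  have "R x ((f ^^ n) x)" for n x
    by (induction n) (auto intro: assms(3,5,6))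
  then show ?thesis using cycle_rel_iff_funpow[OF assms(1)] assms(2,4) by metis
qed

lemma cycle_of_eq:
  assumes "bij f" "cycle_rel f x y"
  shows "cycle_of f x = cycle_of f y"
  using cycle_rel_trans[OF assms(1)] cycle_rel_sym[OF assms(1)] assms(2)
  unfolding cycle_rel_def by blast

lemma CF_cong: "bij f \<Longrightarrow> cycle_rel f x y \<Longrightarrow> x \<in> CF f \<longleftrightarrow> y \<in> CF f"
  using cycle_of_eq[of f x y] by (simp add: CF_def)

lemma cycle_of_periodic:
  assumes "bij f" "n > 0" "(f ^^ n) x = x"
  shows "cycle_of f x = (\<lambda>i. (f ^^ i) x) ` {..<n}"
proof
  have mod: "(f ^^ m) x \<in> (\<lambda>i. (f ^^ i) x) ` {..<n}" for m
    using funpow_mod_eq[OF assms(3), of m] assms(2) by (metis imageI lessThan_iff mod_less_divisor)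
  show "cycle_of f x \<subseteq> (\<lambda>i. (f ^^ i) x) ` {..<n}"
  proof
    fix z assume "z \<in> cycle_of f x"
    then obtain m where "(f ^^ m) x = z \<or> (f ^^ m) z = x"
      using cycle_rel_iff_funpow[OF assms(1)] unfolding cycle_rel_def by blast
    then show "z \<in> (\<lambda>i. (f ^^ i) x) ` {..<n}"
    proof
      assume "(f ^^ m) x = z"
      then show ?thesis using mod by blast
    next
      assume z: "(f ^^ m) z = x"
      \<comment> \<open>Points behind \<open>x\<close> are also ahead of it: \<open>m * n\<close> is
        a multiple of the period and at least \<open>m\<close>, so the iterate of \<open>x\<close>
        with exponent \<open>m * n - m\<close> is its preimage under \<open>f ^^ m\<close>.\<close>
      have "m \<le> m * n" using assms(2) by simp
      then have "(f ^^ m) ((f ^^ (m * n - m)) x) = (f ^^ (m * n)) x"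
        by (metis comp_apply funpow_add le_add_diff_inverse)
      also have "\<dots> = x" using funpow_mod_eq[OF assms(3), of "m * n"] by simp
      finally have "(f ^^ (m * n - m)) x = z"
        using z bij_is_inj[OF bij_fn[OF assms(1), of m]] by (metis injD)
      then show ?thesis using mod by blast
    qed
  qed
  show "(\<lambda>i. (f ^^ i) x) ` {..<n} \<subseteq> cycle_of f x"
    using cycle_rel_iff_funpow[OF assms(1)] unfolding cycle_rel_def by blast
qed

text \<open>By the pigeonhole principle a finite cycle makes two iterates coincide, and injectivity
  shifts the coincidence back to \<open>x\<close>. Finiteness thereby becomes confirmable by
  search.\<close>

lemma CF_iff_periodic:
  assumes "bij f"
  shows "x \<in> CF f \<longleftrightarrow> (\<exists>n > 0. (f ^^ n) x = x)"
proof
  assume "x \<in> CF f"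
  moreover have "range (\<lambda>n. (f ^^ n) x) \<subseteq> cycle_of f x"
    using cycle_rel_iff_funpow[OF assms] unfolding cycle_rel_def by blast
  ultimately have "finite (range (\<lambda>n. (f ^^ n) x))" unfolding CF_def by (simp add: finite_subset)
  then have "\<not> inj (\<lambda>n. (f ^^ n) x)" using finite_imageD infinite_UNIV_nat by blast
  then obtain a b where "a < b" "(f ^^ a) x = (f ^^ b) x"
    unfolding inj_def by (metis linorder_neqE_nat)
  moreover then have "(f ^^ a) ((f ^^ (b - a)) x) = (f ^^ a) x"
    by (metis add_diff_inverse_nat comp_apply funpow_add less_imp_not_less)
  ultimately show "\<exists>n > 0. (f ^^ n) x = x"
    using bij_is_inj[OF bij_fn[OF assms, of a]] by (metis injD zero_less_diff)
next
  assume "\<exists>n > 0. (f ^^ n) x = x"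
  then show "x \<in> CF f" using cycle_of_periodic[OF assms] unfolding CF_def by force
qed

section \<open>A permutation multiplied by one transposition from the left\<close>

locale transposed =
  fixes f g :: "'a \<Rightarrow> 'a" and x y :: 'a
  assumes bij: "bij f" and g_def: "g = Transposition.transpose x y \<circ> f"
begin

lemma bij_g: "bij g"
  unfolding g_def by (rule bij_comp[OF bij bij_transpose])

text \<open>A transposition is an involution, so \<open>f\<close> arises from \<open>g\<close> in
  the same manner. Each fact of the locale is thus available with \<open>f\<close> and
  \<open>g\<close> exchanged.\<close>

lemma transposed_sym: "transposed g f x y"
  by unfold_locales (rule bij_g, simp add: g_def flip: comp_assoc)

lemma transposed_swap: "transposed f g y x"
  by unfold_locales (rule bij, simp add: g_def transpose_commute)

abbreviation merged :: "'a set" where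
  "merged \<equiv> cycle_of f x \<union> cycle_of f y"

lemma mem_merged: "z \<in> merged \<longleftrightarrow> cycle_rel f x z \<or> cycle_rel f y z"
  by (simp add: cycle_rel_def)

text \<open>A step of \<open>g\<close> differs from that of \<open>f\<close> only if
  \<open>f z\<close> is \<open>x\<close> or \<open>y\<close>, and then it starts and ends in
  \<open>merged\<close>. As \<open>merged\<close> is a union of cycles of \<open>f\<close>, the
  disjunction is an equivalence relation and \<open>cycle_rel_least\<close> applies.\<close>

lemma cycle_rel_imp:
  assumes "cycle_rel g z w"
  shows "cycle_rel f z w \<or> z \<in> merged \<and> w \<in> merged"
proof (rule cycle_rel_least[OF bij_g assms])
  fix z
  have z: "cycle_rel f z (f z)" by (rule cycle_rel_step[OF bij])
  have xy: "x \<in> merged" "y \<in> merged" using cycle_rel_refl[OF bij] mem_merged by blast+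
  show "cycle_rel f z (g z) \<or> z \<in> merged \<and> g z \<in> merged"
  proof (cases "f z = x \<or> f z = y")
    case True
    then have "z \<in> merged" using cycle_rel_sym[OF bij z] mem_merged by metis
    then show ?thesis using True xy by (auto simp: g_def)
  next
    case False
    then show ?thesis using z by (simp add: g_def)
  qed
next
  show "cycle_rel f z z \<or> z \<in> merged \<and> z \<in> merged" for z
    using cycle_rel_refl[OF bij] by blast
  show "cycle_rel f w z \<or> w \<in> merged \<and> z \<in> merged"
    if "cycle_rel f z w \<or> z \<in> merged \<and> w \<in> merged" for z w
    using that cycle_rel_sym[OF bij] by blast
  show "cycle_rel f z v \<or> z \<in> merged \<and> v \<in> merged"
    if "cycle_rel f z w \<or> z \<in> merged \<and> w \<in> merged"
      "cycle_rel f w v \<or> w \<in> merged \<and> v \<in> merged" for z w v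
    using that cycle_rel_sym[OF bij] cycle_rel_trans[OF bij] unfolding mem_merged by meson
qed

lemma merged_subset: "cycle_of g x \<union> cycle_of g y \<subseteq> merged"
  using cycle_rel_imp[of x] cycle_rel_imp[of y] unfolding cycle_rel_def by blast

lemma merged_eq: "merged = cycle_of g x \<union> cycle_of g y"
  using merged_subset transposed.merged_subset[OF transposed_sym] by blast

lemma cycle_rel_eq:
  assumes "\<not> (z \<in> merged \<and> w \<in> merged)"
  shows "cycle_rel g z w \<longleftrightarrow> cycle_rel f z w"
  using cycle_rel_imp[of z w] transposed.cycle_rel_imp[OF transposed_sym, of z w] merged_eq assms
  by blast

text \<open>Along the cycle of \<open>f\<close> from \<open>x\<close>, the two permutations agree
  until the first return to \<open>x\<close>, where \<open>g\<close> proceeds to \<open>y\<close>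
  instead.\<close>

lemma joined_if_periodic:
  assumes "x \<noteq> y" "x \<in> CF f" "\<not> cycle_rel f x y"
  shows "cycle_rel g x y"
proof -
  define n where "n = (LEAST n. n > 0 \<and> (f ^^ n) x = x)"
  have n: "n > 0 \<and> (f ^^ n) x = x"
    unfolding n_def using assms(2) CF_iff_periodic[OF bij] by (metis (mono_tags, lifting) LeastI_ex)
  have min: "(f ^^ i) x \<noteq> x" if "0 < i" "i < n" for i
    using not_less_Least[of i "\<lambda>n. n > 0 \<and> (f ^^ n) x = x"] that unfolding n_def by blast
  have y: "(f ^^ i) x \<noteq> y" for i
    using assms(3) cycle_rel_iff_funpow[OF bij] by blast
  have step: "g u = Transposition.transpose x y (f u)" for u by (simp add: g_def)
  have eq: "(g ^^ i) x = (f ^^ i) x" if "i < n" for i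
    using that
  proof (induction i)
    case (Suc i)
    then have "(g ^^ Suc i) x = g ((f ^^ i) x)" by simp
    also have "\<dots> = Transposition.transpose x y ((f ^^ Suc i) x)" by (simp add: step)
    also have "\<dots> = (f ^^ Suc i) x"
      using min[of "Suc i"] y[of "Suc i"] Suc.prems by (intro transpose_apply_other) simp_all
    finally show ?case .
  qed simp
  obtain k where "n = Suc k" using n by (metis gr0_implies_Suc)
  then have "(g ^^ n) x = Transposition.transpose x y ((f ^^ n) x)"
    using eq[of k] by (simp add: step)
  then have "(g ^^ n) x = y" using n by simp
  then show ?thesis using cycle_rel_iff_funpow[OF bij_g] by blast
qed

text \<open>The preceding argument in reverse: before the first arrival of \<open>g\<close> at
  \<open>y\<close> the iterates agree, and at that moment \<open>f\<close> returns to
  \<open>x\<close>. The cycle of \<open>f\<close> closed in this way has not met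
  \<open>y\<close>.\<close>

lemma periodic_if_joined:
  assumes "x \<noteq> y" "(g ^^ k) x = y"
  shows "\<not> cycle_rel f x y \<and> x \<in> CF f"
proof -
  interpret sym: transposed g f x y by (rule transposed_sym)
  define n where "n = (LEAST n. (g ^^ n) x = y)"
  have n: "(g ^^ n) x = y" unfolding n_def using assms(2) by (rule LeastI)
  have y: "(g ^^ i) x \<noteq> y" if "i < n" for i
    using not_less_Least that unfolding n_def by blast
  \<comment> \<open>A return to \<open>x\<close> before step \<open>n\<close> could be cut out,
    which would bring \<open>g\<close> to \<open>y\<close> earlier.\<close>
  have x: "(g ^^ i) x \<noteq> x" if "0 < i" "i < n" for i
  proof
    assume "(g ^^ i) x = x"
    then have "(g ^^ (n - i)) x = (g ^^ n) x"
      using that by (metis comp_apply funpow_add le_add_diff_inverse2 less_imp_le)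
    then show False using n y[of "n - i"] that by simp
  qed
  have step: "f u = Transposition.transpose x y (g u)" for u by (simp add: sym.g_def)
  have eq: "(f ^^ i) x = (g ^^ i) x" if "i < n" for i
    using that
  proof (induction i)
    case (Suc i)
    then have "(f ^^ Suc i) x = f ((g ^^ i) x)" by simp
    also have "\<dots> = Transposition.transpose x y ((g ^^ Suc i) x)" by (simp add: step)
    also have "\<dots> = (g ^^ Suc i) x"
      using x[of "Suc i"] y[of "Suc i"] Suc.prems by (intro transpose_apply_other) simp_all
    finally show ?case .
  qed simp
  have "n > 0" using n assms(1) by (cases n) auto
  then obtain k where "n = Suc k" by (metis gr0_implies_Suc)
  then have "(f ^^ n) x = Transposition.transpose x y ((g ^^ n) x)"
    using eq[of k] by (simp add: step)
  then have per: "(f ^^ n) x = x" using n by simp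
  have "y \<notin> cycle_of f x"
    using cycle_of_periodic[OF bij \<open>n > 0\<close> per] eq y by auto
  then show ?thesis
    using CF_iff_periodic[OF bij] per \<open>n > 0\<close> unfolding cycle_rel_def by blast
qed

text \<open>Two infinite cycles of \<open>f\<close> are not joined: they merely exchange their tails.\<close>

lemma joined_iff:
  assumes "x \<noteq> y"
  shows "cycle_rel g x y \<longleftrightarrow> \<not> cycle_rel f x y \<and> (x \<in> CF f \<or> y \<in> CF f)"
proof -
  interpret swap: transposed f g y x by (rule transposed_swap)
  show ?thesis
  proof
    assume "cycle_rel g x y"
    then obtain k where "(g ^^ k) x = y \<or> (g ^^ k) y = x"
      using cycle_rel_iff_funpow[OF bij_g] by blast
    then show "\<not> cycle_rel f x y \<and> (x \<in> CF f \<or> y \<in> CF f)"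
      using periodic_if_joined[OF assms, of k] swap.periodic_if_joined[OF assms[symmetric], of k]
        cycle_rel_sym[OF bij, of x y] by blast
  next
    assume "\<not> cycle_rel f x y \<and> (x \<in> CF f \<or> y \<in> CF f)"
    then show "cycle_rel g x y"
      using joined_if_periodic[OF assms] swap.joined_if_periodic[OF assms[symmetric]]
        cycle_rel_sym[OF bij_g, of y x] cycle_rel_sym[OF bij, of y x] by blast
  qed
qed

text \<open>The two cycles of \<open>g\<close> are disjoint, so the first hit on either of them
  tells the side of \<open>z\<close>. The disjunct \<open>z \<notin> merged\<close> is false here;
  it matches the guard in \<open>x_side\<close> that makes the search halt for every
  \<open>z\<close>.\<close>

lemma bounded_search:
  assumes "\<not> cycle_rel g x y" "z \<in> merged"
  defines "n \<equiv> LEAST n. z \<notin> merged \<or> ((g ^^ n) x = z \<or> (g ^^ n) z = x)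
    \<or> ((g ^^ n) y = z \<or> (g ^^ n) z = y)"
  shows "(g ^^ n) x = z \<or> (g ^^ n) z = x \<longleftrightarrow> cycle_rel g x z"
proof -
  have "cycle_rel g x z \<or> cycle_rel g y z"
    using assms(2) merged_eq unfolding cycle_rel_def by blast
  then have "\<exists>n. z \<notin> merged \<or> ((g ^^ n) x = z \<or> (g ^^ n) z = x)
    \<or> ((g ^^ n) y = z \<or> (g ^^ n) z = y)"
    using cycle_rel_iff_funpow[OF bij_g] by blast
  then have "z \<notin> merged \<or> ((g ^^ n) x = z \<or> (g ^^ n) z = x)
    \<or> ((g ^^ n) y = z \<or> (g ^^ n) z = y)"
    unfolding n_def by (rule LeastI_ex)
  then have "((g ^^ n) x = z \<or> (g ^^ n) z = x) \<or> ((g ^^ n) y = z \<or> (g ^^ n) z = y)"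
    using assms(2) by blast
  moreover have "(g ^^ n) u = z \<or> (g ^^ n) z = u \<Longrightarrow> cycle_rel g u z" for u
    using cycle_rel_iff_funpow[OF bij_g] by blast
  ultimately show ?thesis
    using assms(1) cycle_rel_trans[OF bij_g, of x z y] cycle_rel_sym[OF bij_g, of y z] by blast
qed

text \<open>At most two cycles of \<open>g\<close> make up \<open>merged\<close>, so being on the
  cycle of \<open>x\<close> or not determines the cycle of a point.\<close>

lemma same_side_iff:
  assumes "z \<in> merged" "w \<in> merged"
  shows "cycle_rel g z w \<longleftrightarrow> cycle_rel g x y \<or> (cycle_rel g x z \<longleftrightarrow> cycle_rel g x w)"
proof -
  have side: "cycle_rel g x u \<or> cycle_rel g y u" if "u \<in> merged" for u
    using that merged_eq unfolding cycle_rel_def by blast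
  note sym = cycle_rel_sym[OF bij_g] and trans = cycle_rel_trans[OF bij_g]
  show ?thesis
  proof (cases "cycle_rel g x z")
    case True
    then show ?thesis
      using side[OF assms(2)] sym[of x z] sym[of y w] sym[of w z] trans[of z x w] trans[of x z w]
        trans[of x y w] trans[of x w y] by blast
  next
    case False
    then have yz: "cycle_rel g y z" using side[OF assms(1)] by blast
    then have "\<not> cycle_rel g x y" using False trans by blast
    then show ?thesis
      using False yz side[OF assms(2)] sym[of z w] sym[of y z] trans[of x w z] trans[of z y w]
      by blast
  qed
qed

lemma CF_outside:
  assumes "z \<notin> merged"
  shows "z \<in> CF g \<longleftrightarrow> z \<in> CF f"
proof -
  have "cycle_of g z = cycle_of f z"
    using cycle_rel_eq[of z] assms unfolding cycle_rel_def by blast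
  then show ?thesis by (simp add: CF_def)
qed

lemma finite_merged: "finite merged \<longleftrightarrow> x \<in> CF f \<and> y \<in> CF f"
  by (simp add: CF_def)

text \<open>If \<open>x\<close> and \<open>y\<close> both have finite cycles under \<open>f\<close>,
  all of \<open>merged\<close> is finite. Otherwise a finite cycle of \<open>g\<close> occurs in
  \<open>merged\<close> only if one infinite cycle was split; then exactly one of \<open>x\<close>
  and \<open>y\<close> has a finite cycle under \<open>g\<close>, and the bounded quantifier singles
  it out.\<close>

lemma mem_merged_CF:
  assumes "z \<in> merged"
  shows "z \<in> CF g \<longleftrightarrow> (x \<in> CF f \<and> y \<in> CF f)
    \<or> (x \<noteq> y \<and> cycle_rel f x y \<and> x \<notin> CF f
       \<and> (\<forall>q \<in> {x, y}. q \<in> CF g \<longrightarrow> cycle_rel g z q))"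
proof -
  interpret sym: transposed g f x y by (rule transposed_sym)
  have z: "cycle_rel g x z \<or> cycle_rel g y z"
    using assms merged_eq unfolding cycle_rel_def by blast
  have fin: "(x \<in> CF g \<and> y \<in> CF g) \<longleftrightarrow> (x \<in> CF f \<and> y \<in> CF f)"
    using finite_merged sym.finite_merged merged_eq by simp
  have same: "cycle_rel g u v \<Longrightarrow> u \<in> CF g \<longleftrightarrow> v \<in> CF g" for u v by (rule CF_cong[OF bij_g])
  show ?thesis
  proof (cases "x \<in> CF f \<and> y \<in> CF f")
    case True
    then show ?thesis using z fin same by blast
  next
    case False
    show ?thesis
    proof (cases "x \<noteq> y \<and> cycle_rel f x y")
      case True
      then have "x \<notin> CF f" using False CF_cong[OF bij] by blast
      moreover have "\<not> cycle_rel g x y" "x \<in> CF g \<or> y \<in> CF g"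
        using sym.joined_iff True by blast+
      ultimately show ?thesis
        using True False fin z same cycle_rel_sym[OF bij_g] cycle_rel_refl[OF bij_g] by blast
    next
      case nsame: False
      have "x \<notin> CF g \<and> y \<notin> CF g"
      proof (cases "x = y")
        case True
        then show ?thesis using fin False by simp
      next
        case ne: False
        then have "\<not> cycle_rel f x y" using nsame by blast
        \<comment> \<open>By \<open>joined_iff\<close> with the roles exchanged, points on different
          cycles of \<open>f\<close> are joined by \<open>g\<close> or both infinite under
          \<open>g\<close>. In the joined case they are finite or infinite together, and
          \<open>fin\<close> excludes the former.\<close>
        then have "cycle_rel g x y \<or> x \<notin> CF g \<and> y \<notin> CF g" using sym.joined_iff[OF ne] by blast
        then show ?thesis using same fin False by blast
      qed
      then show ?thesis using z same nsame False by blast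
    qed
  qed
qed

end

section \<open>Deciders for the product\<close>

datatype setting = Setting (perm: "nat \<Rightarrow> nat") (px: nat) (py: nat) (fins: "nat set")

text \<open>The two points are given by constant programs rather than numbers, since multiplication by a
  transposition from the right involves the value of the permutation at these points.
  Outside of the two points, \<open>fins\<close> need not agree with \<^const>\<open>CF\<close>, which allows for a
  nonuniform choice if \<^const>\<open>CF\<close> is undecidable.\<close>

definition settings :: "(recf list \<times> setting) set" where
  "settings = {(ps, s). bij (perm s) \<and> program_for (ps ! 0) (perm s)
     \<and> rel_decider (ps ! 1) (cycle_rel (perm s)) \<and> set_decider (ps ! 2) (fins s)
     \<and> (\<forall>xs. recf_eval (ps ! 3) xs (px s)) \<and> (\<forall>xs. recf_eval (ps ! 4) xs (py s))
     \<and> (px s \<in> fins s \<or> py s \<in> fins s \<longleftrightarrow> px s \<in> CF (perm s) \<or> py s \<in> CF (perm s))}"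

lemma computable_given:
  assumes "j < n"
    and "\<And>i xs. i \<in> V \<Longrightarrow> length xs = k \<Longrightarrow> recf_eval (fst i ! j) xs (F i xs)"
  shows "computable n V k F"
  unfolding computable_def using codable_nth[OF assms(1)] assms(2) by blast

lemma computable_px: "computable 5 settings k (\<lambda>i xs. px (snd i))"
  by (rule computable_given[of 3]) (auto simp: settings_def)

lemma computable_py: "computable 5 settings k (\<lambda>i xs. py (snd i))"
  by (rule computable_given[of 4]) (auto simp: settings_def)

lemma computable_perm:
  "computable 5 settings k G \<Longrightarrow> computable 5 settings k (\<lambda>i xs. perm (snd i) (G i xs))"
proof (rule computable_comp1[where F = "\<lambda>i. perm (snd i)"])
  show "computable 5 settings 1 (\<lambda>i ys. perm (snd i) (ys ! 0))"
    by (rule computable_given[of 0]) (auto simp: settings_def program_for_def length_Suc_conv)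
qed

lemma decidable_cycle_rel:
  "computable 5 settings k G \<Longrightarrow> computable 5 settings k H
    \<Longrightarrow> decidable 5 settings k (\<lambda>i xs. cycle_rel (perm (snd i)) (G i xs) (H i xs))"
proof (rule decidable_comp2[where P = "\<lambda>i. cycle_rel (perm (snd i))"])
  show "decidable 5 settings 2 (\<lambda>i ys. cycle_rel (perm (snd i)) (ys ! 0) (ys ! 1))"
    unfolding decidable_def
  proof (rule computable_given[of 1])
    fix i :: "recf list \<times> setting" and xs :: "nat list"
    assume i: "i \<in> settings" and "length xs = 2"
    then obtain z w where "xs = [z, w]" by (auto simp: numeral_2_eq_2 length_Suc_conv)
    then show "recf_eval (fst i ! 1) xs (of_bool (cycle_rel (perm (snd i)) (xs ! 0) (xs ! 1)))"
      using i by (simp add: settings_def rel_decider_def of_bool_def split_beta)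
  qed simp
qed

lemma decidable_fins:
  "computable 5 settings k G \<Longrightarrow> decidable 5 settings k (\<lambda>i xs. G i xs \<in> fins (snd i))"
proof (rule decidable_comp1[where P = "\<lambda>i z. z \<in> fins (snd i)"])
  show "decidable 5 settings 1 (\<lambda>i ys. ys ! 0 \<in> fins (snd i))"
    unfolding decidable_def
  proof (rule computable_given[of 2])
    fix i :: "recf list \<times> setting" and xs :: "nat list"
    assume i: "i \<in> settings" and "length xs = 1"
    then obtain z where "xs = [z]" by (auto simp: length_Suc_conv)
    then show "recf_eval (fst i ! 2) xs (of_bool (xs ! 0 \<in> fins (snd i)))"
      using i by (simp add: settings_def set_decider_def of_bool_def split_beta)
  qed simp
qed

section \<open>Deciding the new cycles from the old ones\<close>

definition new_perm :: "setting \<Rightarrow> nat \<Rightarrow> nat" where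
  "new_perm s = Transposition.transpose (px s) (py s) \<circ> perm s"

lemma computable_new_perm:
  assumes "computable 5 settings k G"
  shows "computable 5 settings k (\<lambda>i xs. new_perm (snd i) (G i xs))"
  unfolding new_perm_def comp_apply Transposition.transpose_def
  by (intro computable_if decidable_eq computable_perm computable_px computable_py assms)

definition meets :: "setting \<Rightarrow> nat \<Rightarrow> nat \<Rightarrow> nat \<Rightarrow> bool" where
  "meets s n u z \<longleftrightarrow> (new_perm s ^^ n) u = z \<or> (new_perm s ^^ n) z = u"

lemma decidable_meets:
  assumes "computable 5 settings k N" "computable 5 settings k G" "computable 5 settings k H"
  shows "decidable 5 settings k (\<lambda>i xs. meets (snd i) (N i xs) (G i xs) (H i xs))"
  unfolding meets_def
  by (intro decidable_disj decidable_eq computable_funpow computable_new_perm computable_nth assms)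
    simp_all

definition on_cycles :: "setting \<Rightarrow> nat \<Rightarrow> bool" where
  "on_cycles s z \<longleftrightarrow> cycle_rel (perm s) (px s) z \<or> cycle_rel (perm s) (py s) z"

lemma decidable_on_cycles:
  assumes "computable 5 settings k G"
  shows "decidable 5 settings k (\<lambda>i xs. on_cycles (snd i) (G i xs))"
  unfolding on_cycles_def
  by (intro decidable_disj decidable_cycle_rel computable_px computable_py assms)

text \<open>The guard \<open>\<not> on_cycles s z\<close> makes the search halt everywhere. The
  answer is meaningful for points on the two cycles when these are not joined.\<close>

definition x_side :: "setting \<Rightarrow> nat \<Rightarrow> bool" where
  "x_side s z \<longleftrightarrow>
     meets s (LEAST n. \<not> on_cycles s z \<or> meets s n (px s) z \<or> meets s n (py s) z) (px s) z"

text \<open>The right-hand side of \<open>joined_iff\<close>, with the trivial case of equal points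
  added. \<open>fins\<close> is consulted at the two points alone, which permits the nonuniform
  choice in \<open>Perm_transpose_left\<close>.\<close>

definition joined :: "setting \<Rightarrow> bool" where
  "joined s \<longleftrightarrow> px s = py s
     \<or> \<not> cycle_rel (perm s) (px s) (py s) \<and> (px s \<in> fins s \<or> py s \<in> fins s)"

definition new_rel :: "setting \<Rightarrow> nat \<Rightarrow> nat \<Rightarrow> bool" where
  "new_rel s z w \<longleftrightarrow>
     on_cycles s z \<and> on_cycles s w \<and> (joined s \<or> (x_side s z \<longleftrightarrow> x_side s w))
     \<or> \<not> (on_cycles s z \<and> on_cycles s w) \<and> cycle_rel (perm s) z w"

definition split_infinite :: "setting \<Rightarrow> bool" where
  "split_infinite s \<longleftrightarrow> px s \<noteq> py s \<and> cycle_rel (perm s) (px s) (py s) \<and> px s \<notin> fins s"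

text \<open>Iterates the new permutation from both points in parallel until one returns.
  \<open>Suc n\<close> excludes the trivial zeroth return, and
  \<open>\<not> split_infinite s\<close> makes the search halt in the remaining cases.\<close>

definition finite_point :: "setting \<Rightarrow> nat" where
  "finite_point s =
     (if (new_perm s ^^ Suc (LEAST n. \<not> split_infinite s
            \<or> (new_perm s ^^ Suc n) (px s) = px s \<or> (new_perm s ^^ Suc n) (py s) = py s)) (px s) = px s
      then px s else py s)"

definition new_CF :: "setting \<Rightarrow> nat set" where
  "new_CF s = {z. on_cycles s z \<and> (px s \<in> fins s \<and> py s \<in> fins s
       \<or> split_infinite s \<and> new_rel s z (finite_point s))
     \<or> \<not> on_cycles s z \<and> z \<in> fins s}"

lemma settings_transposed:
  "i \<in> settings \<Longrightarrow> transposed (perm (snd i)) (new_perm (snd i)) (px (snd i)) (py (snd i))"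
  by unfold_locales (auto simp: settings_def new_perm_def)

lemma on_cycles_iff:
  "on_cycles s z \<longleftrightarrow> z \<in> cycle_of (perm s) (px s) \<union> cycle_of (perm s) (py s)"
  by (simp add: on_cycles_def cycle_rel_def)

lemma bounded_search_ex:
  assumes "i \<in> settings"
  shows "\<exists>n. \<not> on_cycles (snd i) z \<or> meets (snd i) n (px (snd i)) z \<or> meets (snd i) n (py (snd i)) z"
proof -
  interpret transposed "perm (snd i)" "new_perm (snd i)" "px (snd i)" "py (snd i)"
    by (rule settings_transposed[OF assms])
  show ?thesis
    unfolding on_cycles_iff meets_def merged_eq using cycle_rel_iff_funpow[OF bij_g]
    unfolding cycle_rel_def by blast
qed

lemma decidable_x_side:
  assumes "computable 5 settings k G"
  shows "decidable 5 settings k (\<lambda>i xs. x_side (snd i) (G i xs))"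
proof (rule decidable_comp1[where P = "\<lambda>i z. x_side (snd i) z", OF _ assms])
  show "decidable 5 settings 1 (\<lambda>i ys. x_side (snd i) (ys ! 0))"
    unfolding x_side_def
    by (intro decidable_meets computable_Least decidable_disj decidable_not decidable_on_cycles
        computable_px computable_py computable_nth computable_Suc_nth bounded_search_ex) simp_all
qed

lemma decidable_new_rel:
  assumes "computable 5 settings k G" "computable 5 settings k H"
  shows "decidable 5 settings k (\<lambda>i xs. new_rel (snd i) (G i xs) (H i xs))"
  unfolding new_rel_def joined_def
  by (intro decidable_disj decidable_conj decidable_not decidable_iff decidable_on_cycles
      decidable_x_side decidable_eq decidable_cycle_rel decidable_fins computable_px computable_py
      assms)

lemma decidable_split_infinite: "decidable 5 settings k (\<lambda>i xs. split_infinite (snd i))"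
  unfolding split_infinite_def
  by (intro decidable_conj decidable_not decidable_eq decidable_cycle_rel decidable_fins
      computable_px computable_py)

lemma split_infinite_imp:
  assumes "i \<in> settings" "split_infinite (snd i)"
  shows "px (snd i) \<in> CF (new_perm (snd i)) \<or> py (snd i) \<in> CF (new_perm (snd i))"
proof -
  interpret transposed "new_perm (snd i)" "perm (snd i)" "px (snd i)" "py (snd i)"
    by (rule transposed.transposed_sym[OF settings_transposed[OF assms(1)]])
  show ?thesis using assms(2) joined_iff unfolding split_infinite_def by blast
qed

lemma finite_point_ex:
  assumes "i \<in> settings"
  shows "\<exists>n. \<not> split_infinite (snd i) \<or> (new_perm (snd i) ^^ Suc n) (px (snd i)) = px (snd i)
    \<or> (new_perm (snd i) ^^ Suc n) (py (snd i)) = py (snd i)"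
proof -
  have "bij (new_perm (snd i))"
    by (rule transposed.bij_g[OF settings_transposed[OF assms]])
  then have "\<exists>n. (new_perm (snd i) ^^ Suc n) u = u" if "u \<in> CF (new_perm (snd i))" for u
    using that CF_iff_periodic by (metis gr0_implies_Suc)
  then show ?thesis using split_infinite_imp[OF assms] by blast
qed

lemma finite_point_CF:
  assumes "i \<in> settings" "split_infinite (snd i)"
  shows "finite_point (snd i) \<in> {px (snd i), py (snd i)} \<inter> CF (new_perm (snd i))"
proof -
  have "bij (new_perm (snd i))"
    by (rule transposed.bij_g[OF settings_transposed[OF assms(1)]])
  then have per: "u \<in> CF (new_perm (snd i))" if "(new_perm (snd i) ^^ Suc n) u = u" for u n
    using that CF_iff_periodic by (metis zero_less_Suc)
  show ?thesis
    using LeastI_ex[OF finite_point_ex[OF assms(1)]] assms(2) per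
    unfolding finite_point_def by (auto simp del: funpow.simps)
qed

lemma computable_finite_point: "computable 5 settings k (\<lambda>i xs. finite_point (snd i))"
  unfolding finite_point_def
  by (intro computable_if decidable_eq computable_funpow computable_Suc computable_Least
      decidable_disj decidable_not decidable_split_infinite computable_new_perm
      computable_px computable_py computable_nth finite_point_ex) simp_all

lemma decidable_new_CF:
  assumes "computable 5 settings k G"
  shows "decidable 5 settings k (\<lambda>i xs. G i xs \<in> new_CF (snd i))"
  unfolding new_CF_def mem_Collect_eq
  by (intro decidable_disj decidable_conj decidable_not decidable_on_cycles decidable_new_rel
      decidable_split_infinite decidable_fins computable_finite_point computable_px computable_py
      assms)

lemma new_rel_iff:
  assumes "i \<in> settings"
  shows "new_rel (snd i) z w \<longleftrightarrow> cycle_rel (new_perm (snd i)) z w"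
proof -
  interpret transposed "perm (snd i)" "new_perm (snd i)" "px (snd i)" "py (snd i)"
    by (rule settings_transposed[OF assms])
  \<comment> \<open>Equal points are related by reflexivity; for distinct ones the last clause of
    \<open>settings\<close> turns the condition on \<open>fins\<close> into that on
    \<open>CF\<close> in \<open>joined_iff\<close>.\<close>
  have joined: "joined (snd i) \<longleftrightarrow> cycle_rel (new_perm (snd i)) (px (snd i)) (py (snd i))"
    using assms joined_iff cycle_rel_refl[OF bij_g, of "py (snd i)"]
    unfolding joined_def settings_def by force
  have side: "x_side (snd i) z \<longleftrightarrow> cycle_rel (new_perm (snd i)) (px (snd i)) z"
    if "\<not> joined (snd i)" "z \<in> merged" for z
    using bounded_search[OF that(1)[unfolded joined] that(2)]
    unfolding x_side_def meets_def on_cycles_iff .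
  show ?thesis
  proof (cases "z \<in> merged \<and> w \<in> merged")
    case True
    then show ?thesis
      using same_side_iff[of z w] side joined unfolding new_rel_def on_cycles_iff by blast
  next
    case False
    then show ?thesis using cycle_rel_eq[OF False] unfolding new_rel_def on_cycles_iff by blast
  qed
qed

lemma new_CF_eq:
  assumes "i \<in> settings" and fins: "fins (snd i) = CF (perm (snd i))"
  shows "new_CF (snd i) = CF (new_perm (snd i))"
proof (rule set_eqI)
  fix z
  interpret transposed "perm (snd i)" "new_perm (snd i)" "px (snd i)" "py (snd i)"
    by (rule settings_transposed[OF assms(1)])
  show "z \<in> new_CF (snd i) \<longleftrightarrow> z \<in> CF (new_perm (snd i))"
  proof (cases "z \<in> merged")
    case False
    then show ?thesis using CF_outside fins unfolding new_CF_def on_cycles_iff by blast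
  next
    case True
    \<comment> \<open>In one direction \<open>finite_point\<close> instantiates the bounded
      quantifier of \<open>mem_merged_CF\<close>; in the other its finiteness passes to
      \<open>z\<close> by \<open>CF_cong\<close>.\<close>
    have "split_infinite (snd i) \<Longrightarrow> z \<in> CF (new_perm (snd i)) \<longleftrightarrow> new_rel (snd i) z (finite_point (snd i))"
      using finite_point_CF[OF assms(1)] mem_merged_CF[OF True] new_rel_iff[OF assms(1)]
        CF_cong[OF bij_g, of z] fins unfolding split_infinite_def by blast
    then show ?thesis
      using True mem_merged_CF[OF True] fins
      unfolding new_CF_def split_infinite_def on_cycles_iff by blast
  qed
qed

text \<open>The templates are obtained before any setting is given, which is the source of
  uniformity. Equality of \<open>fins\<close> with \<open>CF\<close> is asked for in the third
  conclusion alone, so the first two apply even if \<open>CF (perm s)\<close> is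
  undecidable.\<close>

lemma transposition_templates:
  obtains Tp Td Tc where "codable 5 Tp" "codable 5 Td" "codable 5 Tc"
    "\<And>ps s. (ps, s) \<in> settings \<Longrightarrow> program_for (Tp ps) (new_perm s)"
    "\<And>ps s. (ps, s) \<in> settings \<Longrightarrow> rel_decider (Td ps) (cycle_rel (new_perm s))"
    "\<And>ps s. (ps, s) \<in> settings \<Longrightarrow> fins s = CF (perm s) \<Longrightarrow> set_decider (Tc ps) (CF (new_perm s))"
proof -
  have "computable 5 settings 1 (\<lambda>i ys. new_perm (snd i) (ys ! 0))"
    by (intro computable_new_perm computable_nth) simp
  then obtain Tp where Tp: "codable 5 Tp" "\<And>i ys. i \<in> settings \<Longrightarrow> length ys = 1
      \<Longrightarrow> recf_eval (Tp (fst i)) ys (new_perm (snd i) (ys ! 0))"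
    by (rule computableE) blast
  have "decidable 5 settings 2 (\<lambda>i ys. new_rel (snd i) (ys ! 0) (ys ! 1))"
    by (intro decidable_new_rel computable_nth) simp_all
  then obtain Td where Td: "codable 5 Td" "\<And>i ys. i \<in> settings \<Longrightarrow> length ys = 2
      \<Longrightarrow> recf_eval (Td (fst i)) ys (of_bool (new_rel (snd i) (ys ! 0) (ys ! 1)))"
    unfolding decidable_def by (rule computableE) blast
  have "decidable 5 settings 1 (\<lambda>i ys. ys ! 0 \<in> new_CF (snd i))"
    by (intro decidable_new_CF computable_nth) simp
  then obtain Tc where Tc: "codable 5 Tc" "\<And>i ys. i \<in> settings \<Longrightarrow> length ys = 1
      \<Longrightarrow> recf_eval (Tc (fst i)) ys (of_bool (ys ! 0 \<in> new_CF (snd i)))"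
    unfolding decidable_def by (rule computableE) blast
  show ?thesis
  proof (rule that[OF Tp(1) Td(1) Tc(1)])
    fix ps s assume s: "(ps, s) \<in> settings"
    show "program_for (Tp ps) (new_perm s)"
      unfolding program_for_def using Tp(2)[OF s, of "[z]" for z] by simp
    show "rel_decider (Td ps) (cycle_rel (new_perm s))"
      unfolding rel_decider_def using Td(2)[OF s, of "[z, w]" for z w] new_rel_iff[OF s]
      by (simp add: of_bool_def)
    show "set_decider (Tc ps) (CF (new_perm s))" if "fins s = CF (perm s)"
      unfolding set_decider_def using Tc(2)[OF s, of "[z]" for z] new_CF_eq[OF s] that
      by (simp add: of_bool_def)
  qed
qed

section \<open>Closure of \<open>Perm\<close> under finitary factors\<close>

lemma comp_transpose_eq:
  assumes "bij f"
  shows "f \<circ> Transposition.transpose x y = Transposition.transpose (f x) (f y) \<circ> f"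
  using bij_is_inj[OF assms] by (auto simp: fun_eq_iff Transposition.transpose_def inj_eq)

lemma Perm_transpose_left:
  assumes "f \<in> Perm"
  shows "Transposition.transpose x y \<circ> f \<in> Perm"
proof -
  obtain p d where pd: "bij f" "program_for p f" "rel_decider d (cycle_rel f)"
    using assms unfolding Perm_def rec_perms_def by blast
  \<comment> \<open>In either case \<open>A\<close> has a constant decider, and yet it satisfies the
    clause of \<open>settings\<close> about the two points. The case is chosen classically, without
    a decider for \<open>CF f\<close>.\<close>
  define A :: "nat set" where "A = (if x \<in> CF f \<or> y \<in> CF f then UNIV else {})"
  define c where "c = recf_const (if x \<in> CF f \<or> y \<in> CF f then 1 else 0)"
  have "set_decider c A"
    unfolding set_decider_def A_def c_def
    using recf_eval_const[of 0] recf_eval_const[of 1] by auto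
  then have s: "([p, d, c, recf_const x, recf_const y], Setting f x y A) \<in> settings"
    using pd recf_eval_const unfolding settings_def by (simp add: A_def)
  obtain Tp Td Tc where
    "\<And>ps s. (ps, s) \<in> settings \<Longrightarrow> program_for (Tp ps) (new_perm s)"
    "\<And>ps s. (ps, s) \<in> settings \<Longrightarrow> rel_decider (Td ps) (cycle_rel (new_perm s))"
    by (rule transposition_templates) blast
  from this[OF s] have "\<exists>p. program_for p (Transposition.transpose x y \<circ> f)"
    "\<exists>d. rel_decider d (cycle_rel (Transposition.transpose x y \<circ> f))"
    unfolding new_perm_def by auto
  moreover have "bij (Transposition.transpose x y \<circ> f)"
    by (rule bij_comp[OF pd(1) bij_transpose])
  ultimately show ?thesis unfolding Perm_def rec_perms_def by blast
qed

lemma Perm_transpose_right: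
  assumes "f \<in> Perm"
  shows "f \<circ> Transposition.transpose x y \<in> Perm"
proof -
  have "bij f" using assms unfolding Perm_def rec_perms_def by blast
  then show ?thesis using Perm_transpose_left[OF assms] by (simp only: comp_transpose_eq)
qed

lemma transpositions_Nil [simp]: "transpositions [] = id"
  by (simp add: transpositions_def)

lemma transpositions_Cons [simp]:
  "transpositions ((x, y) # ps) = Transposition.transpose x y \<circ> transpositions ps"
  by (simp add: transpositions_def)

lemma transpositions_append:
  "transpositions (ps @ qs) = transpositions ps \<circ> transpositions qs"
  by (induction ps) (auto simp: comp_assoc)

lemma finitary_transpositions:
  assumes "finitary a"
  obtains ps where "a = transpositions ps"
proof -
  have "permutation a" using assms by (simp add: finitary_def permutation)
  then obtain n where "swapidseq n a" unfolding permutation_def by blast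
  then have "\<exists>ps. a = transpositions ps"
  proof induction
    case id
    show ?case by (rule exI[of _ "[]"]) simp
  next
    case (comp_Suc n p x y)
    then obtain ps where "p = transpositions ps" by blast
    then show ?case by (intro exI[of _ "(x, y) # ps"]) simp
  qed
  then show ?thesis using that by blast
qed

lemma Perm_transpositions:
  assumes "f \<in> Perm"
  shows "transpositions ps \<circ> f \<circ> transpositions qs \<in> Perm"
proof -
  have "f \<circ> transpositions qs \<in> Perm"
  proof (induction qs rule: rev_induct)
    case (snoc q qs)
    obtain x y where "q = (x, y)" by fastforce
    then show ?case
      using Perm_transpose_right[OF snoc, of x y]
      by (simp only: transpositions_append transpositions_Cons transpositions_Nil comp_assoc comp_id)
  qed (simp add: assms)
  then show ?thesis
  proof (induction ps)
    case (Cons q ps)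
    obtain x y where "q = (x, y)" by fastforce
    then show ?case
      using Perm_transpose_left[OF Cons.IH[OF Cons.prems], of x y]
      by (simp only: transpositions_Cons comp_assoc)
  qed simp
qed

section \<open>Uniform computation on codes\<close>

text \<open>Three codes are packed into one number because the recursion over a list of
  transpositions passes a single number from step to step.\<close>

definition represents :: "nat \<Rightarrow> (nat \<Rightarrow> nat) \<Rightarrow> bool" where
  "represents z f \<longleftrightarrow> bij f
     \<and> (\<exists>p d c. z = prod_encode (recf_code p, prod_encode (recf_code d, recf_code c))
         \<and> program_for p f \<and> rel_decider d (cycle_rel f) \<and> set_decider c (CF f))"

text \<open>No programs are given and the parameter is a dummy, so the closure lemmas for
  \<open>computable\<close> become available for plain recursive functions.\<close>

abbreviation recursive :: "nat \<Rightarrow> (nat list \<Rightarrow> nat) \<Rightarrow> bool" where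
  "recursive k F \<equiv> computable 0 {([], ())} k (\<lambda>i. F)"

text \<open>Arithmetic on codes plugs programs together but does not run them, so values of
  \<open>f\<close> are not at hand as numbers. The two points therefore enter as codes of programs
  with constant output.\<close>

lemma recursive_multiplication:
  obtains J where "recursive 3 (\<lambda>ys. J (ys ! 0) (ys ! 1) (ys ! 2))"
    "\<And>z f q r x y. represents z f \<Longrightarrow> \<forall>xs. recf_eval q xs x \<Longrightarrow> \<forall>xs. recf_eval r xs y
      \<Longrightarrow> represents (J z (recf_code q) (recf_code r)) (Transposition.transpose x y \<circ> f)"
proof -
  obtain Tp Td Tc where T: "codable 5 Tp" "codable 5 Td" "codable 5 Tc"
    "\<And>ps s. (ps, s) \<in> settings \<Longrightarrow> program_for (Tp ps) (new_perm s)"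
    "\<And>ps s. (ps, s) \<in> settings \<Longrightarrow> rel_decider (Td ps) (cycle_rel (new_perm s))"
    "\<And>ps s. (ps, s) \<in> settings \<Longrightarrow> fins s = CF (perm s) \<Longrightarrow> set_decider (Tc ps) (CF (new_perm s))"
    by (rule transposition_templates) blast
  obtain Fp Fd Fc where F: "total_recursive 5 Fp" "total_recursive 5 Fd" "total_recursive 5 Fc"
    "\<And>ps. length ps = 5 \<Longrightarrow> Fp (map recf_code ps) = recf_code (Tp ps)"
    "\<And>ps. length ps = 5 \<Longrightarrow> Fd (map recf_code ps) = recf_code (Td ps)"
    "\<And>ps. length ps = 5 \<Longrightarrow> Fc (map recf_code ps) = recf_code (Tc ps)"
    using T(1-3) unfolding codable_def by metis
  define arg where "arg z q r = [fst (prod_decode z), fst (prod_decode (snd (prod_decode z))),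
    snd (prod_decode (snd (prod_decode z))), q, r]" for z q r :: nat
  define J where "J z q r =
    prod_encode (Fp (arg z q r), prod_encode (Fd (arg z q r), Fc (arg z q r)))" for z q r
  have comp: "recursive 3 (\<lambda>ys. F (arg (ys ! 0) (ys ! 1) (ys ! 2)))"
    if F: "total_recursive 5 F" for F
  proof -
    let ?V = "{([], ())} :: (recf list \<times> unit) set"
    let ?Gs = "[\<lambda>i ys. fst (prod_decode (ys ! 0)),
      \<lambda>i ys. fst (prod_decode (snd (prod_decode (ys ! 0)))),
      \<lambda>i ys. snd (prod_decode (snd (prod_decode (ys ! 0)))), \<lambda>i ys. ys ! 1, \<lambda>i ys. ys ! 2]
      :: (recf list \<times> unit \<Rightarrow> nat list \<Rightarrow> nat) list"
    have "recursive 3 (\<lambda>ys. fst (prod_decode (ys ! 0)))"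
      "recursive 3 (\<lambda>ys. fst (prod_decode (snd (prod_decode (ys ! 0)))))"
      "recursive 3 (\<lambda>ys. snd (prod_decode (snd (prod_decode (ys ! 0)))))"
      "recursive 3 (\<lambda>ys. ys ! 1)" "recursive 3 (\<lambda>ys. ys ! 2)"
      by (intro computable_prod_decode computable_nth; simp)+
    then have "\<forall>G \<in> set ?Gs. computable 0 ?V 3 G" by simp
    then have "computable 0 ?V 3 G" if "G \<in> set ?Gs" for G using that by blast
    then have "computable 0 ?V 3 (\<lambda>i ys. F (map (\<lambda>G. G i ys) ?Gs))"
      by (rule computable_comp[OF computable_total_recursive[OF F]]) simp_all
    then show ?thesis by (simp add: arg_def)
  qed
  show ?thesis
  proof (rule that)
    show "recursive 3 (\<lambda>ys. J (ys ! 0) (ys ! 1) (ys ! 2))"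
      unfolding J_def by (intro computable_prod_encode comp F)
    fix z f q r x y
    assume "represents z f" and q: "\<forall>xs. recf_eval q xs x" and r: "\<forall>xs. recf_eval r xs y"
    then obtain p d c where z: "z = prod_encode (recf_code p, prod_encode (recf_code d, recf_code c))"
      and f: "bij f" "program_for p f" "rel_decider d (cycle_rel f)" "set_decider c (CF f)"
      unfolding represents_def by blast
    define ps where "ps = [p, d, c, q, r]"
    have s: "(ps, Setting f x y (CF f)) \<in> settings"
      using f q r unfolding settings_def ps_def by simp
    have "arg z (recf_code q) (recf_code r) = map recf_code ps"
      by (simp add: arg_def z ps_def)
    then have J: "J z (recf_code q) (recf_code r)
        = prod_encode (recf_code (Tp ps), prod_encode (recf_code (Td ps), recf_code (Tc ps)))"
      using F(4-6)[of ps] by (simp add: J_def ps_def)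
    have "bij (Transposition.transpose x y \<circ> f)" by (rule bij_comp[OF f(1) bij_transpose])
    then show "represents (J z (recf_code q) (recf_code r)) (Transposition.transpose x y \<circ> f)"
      unfolding represents_def J using T(4-6)[OF s] by (auto simp: new_perm_def)
  qed
qed

text \<open>Recursion along \<open>recf_const\<close>: the tag 3 is that of \<open>Comp\<close>, and
  \<open>Suc (prod_encode (r, 0))\<close> encodes the one-element list holding
  \<open>r\<close>.\<close>

lemma computable_const_code:
  assumes "computable n V k F"
  shows "computable n V k (\<lambda>i xs. recf_code (recf_const (F i xs)))"
proof (rule computable_cong)
  show "computable n V k (\<lambda>i xs. rec_nat (recf_code Zero)
      (\<lambda>m r. prod_encode (3, prod_encode (recf_code Succ, Suc (prod_encode (r, 0))))) (F i xs))"
    by (intro computable_rec_nat computable_prod_encode computable_Suc computable_const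
        computable_nth assms) simp
  have "rec_nat (recf_code Zero)
      (\<lambda>m r. prod_encode (3, prod_encode (recf_code Succ, Suc (prod_encode (r, 0))))) m
    = recf_code (recf_const m)" for m
    by (induction m) simp_all
  then show "rec_nat (recf_code Zero)
      (\<lambda>m r. prod_encode (3, prod_encode (recf_code Succ, Suc (prod_encode (r, 0))))) (F i xs)
    = recf_code (recf_const (F i xs))" for i xs .
qed

lemma recursive_steps:
  obtains L R where "recursive 2 (\<lambda>ys. L (ys ! 0) (ys ! 1))" "recursive 2 (\<lambda>ys. R (ys ! 0) (ys ! 1))"
    "\<And>z f x y. represents z f
      \<Longrightarrow> represents (L z (prod_encode (x, y))) (Transposition.transpose x y \<circ> f)"
    "\<And>z f x y. represents z f
      \<Longrightarrow> represents (R z (prod_encode (x, y))) (f \<circ> Transposition.transpose x y)"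
proof -
  obtain J where J: "recursive 3 (\<lambda>ys. J (ys ! 0) (ys ! 1) (ys ! 2))"
    "\<And>z f q r x y. represents z f \<Longrightarrow> \<forall>xs. recf_eval q xs x \<Longrightarrow> \<forall>xs. recf_eval r xs y
      \<Longrightarrow> represents (J z (recf_code q) (recf_code r)) (Transposition.transpose x y \<circ> f)"
    by (rule recursive_multiplication) blast
  let ?V = "{([], ())} :: (recf list \<times> unit) set"
  have Jcomp: "recursive 2 (\<lambda>ys. J (F ys) (G ys) (H ys))"
    if "recursive 2 F" "recursive 2 G" "recursive 2 H" for F G H
    using computable_comp[OF J(1), of "[\<lambda>i. F, \<lambda>i. G, \<lambda>i. H]" 2] that by auto
  define app where "app p q = prod_encode (3, prod_encode (p, Suc (prod_encode (q, 0))))" for p q :: nat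
  define L where "L z e = J z (recf_code (recf_const (fst (prod_decode e))))
    (recf_code (recf_const (snd (prod_decode e))))" for z e
  \<comment> \<open>By \<open>comp_transpose_eq\<close> the factor moves to the left with the points
    \<open>f x\<close> and \<open>f y\<close>; these are given as the program for \<open>f\<close>
    composed with constant programs.\<close>
  define R where "R z e = J z
    (app (fst (prod_decode z)) (recf_code (recf_const (fst (prod_decode e)))))
    (app (fst (prod_decode z)) (recf_code (recf_const (snd (prod_decode e)))))" for z e
  show ?thesis
  proof (rule that)
    show "recursive 2 (\<lambda>ys. L (ys ! 0) (ys ! 1))"
      unfolding L_def
      by (intro Jcomp computable_const_code computable_prod_decode computable_nth) simp_all
    show "recursive 2 (\<lambda>ys. R (ys ! 0) (ys ! 1))"
      unfolding R_def app_def
      by (intro Jcomp computable_prod_encode computable_Suc computable_const computable_const_code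
          computable_prod_decode computable_nth) simp_all
    fix z f x y assume z: "represents z f"
    show "represents (L z (prod_encode (x, y))) (Transposition.transpose x y \<circ> f)"
      unfolding L_def prod_encode_inverse fst_conv snd_conv
      using J(2)[OF z] recf_eval_const by blast
    obtain p d c where p: "z = prod_encode (recf_code p, prod_encode (recf_code d, recf_code c))"
      "bij f" "program_for p f" using z unfolding represents_def by blast
    have app: "app (fst (prod_decode z)) (recf_code q) = recf_code (Comp p [q])" for q
      by (simp add: app_def p(1))
    have "\<forall>xs. recf_eval (Comp p [recf_const w]) xs (f w)" for w
      using p(3) recf_eval_Comp1[OF recf_eval_const] unfolding program_for_def by blast
    then show "represents (R z (prod_encode (x, y))) (f \<circ> Transposition.transpose x y)"
      unfolding R_def prod_encode_inverse fst_conv snd_conv app comp_transpose_eq[OF p(2)]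
      using J(2)[OF z] by blast
  qed
qed

text \<open>A nonempty list is encoded as the successor of a pair of head and tail code, so
  \<open>l - 1\<close> uncovers the pair.\<close>

definition nth_code :: "nat \<Rightarrow> nat \<Rightarrow> nat" where
  "nth_code l j = fst (prod_decode (((\<lambda>l. snd (prod_decode (l - 1))) ^^ j) l - 1))"

lemma nth_code: "j < length xs \<Longrightarrow> nth_code (list_encode xs) j = xs ! j"
proof (induction xs arbitrary: j)
  case (Cons x xs)
  show ?case
  proof (cases j)
    case (Suc m)
    then have "nth_code (list_encode (x # xs)) j = nth_code (list_encode xs) m"
      by (simp add: nth_code_def funpow_swap1 flip: funpow.simps(2) del: funpow.simps)
        (simp add: funpow_Suc_right del: funpow.simps)
    then show ?thesis using Cons Suc by simp
  qed (simp add: nth_code_def)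
qed simp

lemma computable_nth_code:
  assumes "computable n V k F" "computable n V k G"
  shows "computable n V k (\<lambda>i xs. nth_code (F i xs) (G i xs))"
  unfolding nth_code_def
  by (intro computable_prod_decode computable_minus computable_funpow computable_nth
      computable_const assms) simp

lemma recursive_finitary_multiplication:
  obtains M where "recursive 5 M"
    "\<And>p d c u v a f b. represents (prod_encode (p, prod_encode (d, c))) f \<Longrightarrow> eta_index u a
      \<Longrightarrow> eta_index v b \<Longrightarrow> represents (M [p, d, c, u, v]) (a \<circ> f \<circ> b)"
proof -
  obtain L R where LR: "recursive 2 (\<lambda>ys. L (ys ! 0) (ys ! 1))" "recursive 2 (\<lambda>ys. R (ys ! 0) (ys ! 1))"
    and L: "\<And>z f x y. represents z f
      \<Longrightarrow> represents (L z (prod_encode (x, y))) (Transposition.transpose x y \<circ> f)"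
    and R: "\<And>z f x y. represents z f
      \<Longrightarrow> represents (R z (prod_encode (x, y))) (f \<circ> Transposition.transpose x y)"
    by (rule recursive_steps) blast
  \<comment> \<open>The last transposition of a left factor stands next to \<open>f\<close> and is
    multiplied on first. Hence the list is read from its end, with index the length minus
    \<open>Suc m\<close>, whereas \<open>mulR\<close> reads from the front.\<close>
  define mulL where "mulL z u = rec_nat z
    (\<lambda>m r. L r (nth_code (snd (prod_decode u)) (fst (prod_decode u) - Suc m))) (fst (prod_decode u))"
    for z u
  define mulR where "mulR z v = rec_nat z
    (\<lambda>m r. R r (nth_code (snd (prod_decode v)) m)) (fst (prod_decode v))" for z v
  have mulL: "represents (mulL z u) (a \<circ> f)" if z: "represents z f" and "eta_index u a" for z f u a
  proof -
    from that(2) obtain ps where u: "u = prod_encode (length ps, list_encode (map prod_encode ps))"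
      and a: "a = transpositions ps" unfolding eta_index_def by blast
    let ?s = "\<lambda>m r. L r (nth_code (list_encode (map prod_encode ps)) (length ps - Suc m))"
    have "m \<le> length ps \<Longrightarrow>
      represents (rec_nat z ?s m) (transpositions (drop (length ps - m) ps) \<circ> f)" for m
    proof (induction m)
      case (Suc m)
      define j where "j = length ps - Suc m"
      obtain x y where xy: "ps ! j = (x, y)" by fastforce
      have j: "j < length ps" "Suc j = length ps - m" using Suc.prems by (auto simp: j_def)
      then have "drop j ps = (x, y) # drop (length ps - m) ps"
        using Cons_nth_drop_Suc[OF j(1)] xy by simp
      moreover have "nth_code (list_encode (map prod_encode ps)) j = prod_encode (x, y)"
        using j xy by (simp add: nth_code)
      ultimately show ?case
        using L[OF Suc.IH, of x y] Suc.prems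
        by (simp only: transpositions_Cons comp_assoc old.nat.simps(7) j_def[symmetric] Suc_leD)
    qed (simp add: z)
    from this[of "length ps"] show ?thesis by (simp add: mulL_def u a)
  qed
  have mulR: "represents (mulR z v) (f \<circ> b)" if z: "represents z f" and "eta_index v b" for z f v b
  proof -
    from that(2) obtain ps where v: "v = prod_encode (length ps, list_encode (map prod_encode ps))"
      and b: "b = transpositions ps" unfolding eta_index_def by blast
    let ?s = "\<lambda>m r. R r (nth_code (list_encode (map prod_encode ps)) m)"
    have "m \<le> length ps \<Longrightarrow>
      represents (rec_nat z ?s m) (f \<circ> transpositions (take m ps))" for m
    proof (induction m)
      case (Suc m)
      obtain x y where xy: "ps ! m = (x, y)" by fastforce
      have m: "m < length ps" using Suc.prems by simp
      then have "take (Suc m) ps = take m ps @ [(x, y)]"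
        using xy by (simp add: take_Suc_conv_app_nth)
      moreover have "nth_code (list_encode (map prod_encode ps)) m = prod_encode (x, y)"
        using m xy by (simp add: nth_code)
      ultimately show ?case
        using R[OF Suc.IH, of x y] Suc.prems
        by (simp only: transpositions_append transpositions_Cons transpositions_Nil comp_assoc
            comp_id old.nat.simps(7) Suc_leD)
    qed (simp add: z)
    from this[of "length ps"] show ?thesis by (simp add: mulR_def v b)
  qed
  have step: "computable 0 {([], ())} k (\<lambda>i ys. S (F i ys) (G i ys))"
    if "recursive 2 (\<lambda>ys. S (ys ! 0) (ys ! 1))" "computable 0 {([], ())} k F"
      "computable 0 {([], ())} k G" for S F G and k
    using computable_comp2[OF that(1,2,3)] .
  show ?thesis
  proof (rule that)
    show "recursive 5 (\<lambda>ys. mulR (mulL (prod_encode (ys ! 0, prod_encode (ys ! 1, ys ! 2))) (ys ! 3)) (ys ! 4))"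
      unfolding mulR_def mulL_def
      by (intro computable_rec_nat step[OF LR(1)] step[OF LR(2)] computable_prod_encode
          computable_nth_code computable_minus computable_Suc computable_prod_decode computable_nth
          computable_drop_nth) simp_all
    fix p d c u v a f b
    assume "represents (prod_encode (p, prod_encode (d, c))) f" "eta_index u a" "eta_index v b"
    then show "represents (mulR (mulL (prod_encode ([p, d, c, u, v] ! 0,
        prod_encode ([p, d, c, u, v] ! 1, [p, d, c, u, v] ! 2))) ([p, d, c, u, v] ! 3))
        ([p, d, c, u, v] ! 4)) (a \<circ> f \<circ> b)"
      using mulR mulL by simp
  qed
qed

lemma Perm_CF_represents:
  assumes "represents z f"
  shows "f \<in> Perm_CF"
  using assms unfolding represents_def Perm_CF_def Perm_def rec_perms_def by blast

theorem theorem4p17: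
  shows "(\<forall>a b f. finitary a \<and> finitary b \<and> f \<in> Perm \<longrightarrow> a \<circ> f \<circ> b \<in> Perm)
    \<and> (\<forall>a b f. finitary a \<and> finitary b \<and> f \<in> Perm_CF \<longrightarrow> a \<circ> f \<circ> b \<in> Perm_CF)
    \<and> (\<exists>P Q. \<forall>a b f p d c u v.
          finitary a \<and> finitary b \<and> f \<in> Perm_CF
          \<and> program_for p f \<and> rel_decider d (cycle_rel f) \<and> set_decider c (CF f)
          \<and> eta_index u a \<and> eta_index v b
          \<longrightarrow> (\<exists>d' c'.
                recf_eval P [recf_code p, recf_code d, recf_code c, u, v] (recf_code d')
              \<and> recf_eval Q [recf_code p, recf_code d, recf_code c, u, v] (recf_code c')
              \<and> rel_decider d' (cycle_rel (a \<circ> f \<circ> b))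
              \<and> set_decider c' (CF (a \<circ> f \<circ> b))))"
proof (intro conjI)
  show "\<forall>a b f. finitary a \<and> finitary b \<and> f \<in> Perm \<longrightarrow> a \<circ> f \<circ> b \<in> Perm"
    using Perm_transpositions finitary_transpositions by metis
  obtain M where M: "recursive 5 M"
    "\<And>p d c u v a f b. represents (prod_encode (p, prod_encode (d, c))) f \<Longrightarrow> eta_index u a
      \<Longrightarrow> eta_index v b \<Longrightarrow> represents (M [p, d, c, u, v]) (a \<circ> f \<circ> b)"
    by (rule recursive_finitary_multiplication) blast
  show "\<forall>a b f. finitary a \<and> finitary b \<and> f \<in> Perm_CF \<longrightarrow> a \<circ> f \<circ> b \<in> Perm_CF"
  proof (intro allI impI)
    fix a b f :: "nat \<Rightarrow> nat" assume *: "finitary a \<and> finitary b \<and> f \<in> Perm_CF"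
    then obtain p d c where
      "represents (prod_encode (recf_code p, prod_encode (recf_code d, recf_code c))) f"
      unfolding represents_def Perm_CF_def Perm_def rec_perms_def by blast
    \<comment> \<open>Finitary permutations have some index, so the nonuniform statement follows
      from the uniform function \<open>M\<close>.\<close>
    moreover obtain u v where "eta_index u a" "eta_index v b"
      using * finitary_transpositions unfolding eta_index_def by metis
    ultimately show "a \<circ> f \<circ> b \<in> Perm_CF" using M(2) Perm_CF_represents by blast
  qed
  \<comment> \<open>\<open>M\<close> yields a packed triple; its second and third components are the
    codes of the two deciders.\<close>
  have rec: "recursive 5 (\<lambda>ys. fst (prod_decode (snd (prod_decode (M ys)))))"
    "recursive 5 (\<lambda>ys. snd (prod_decode (snd (prod_decode (M ys)))))"
    by (intro computable_prod_decode M)+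
  obtain P Q where PQ:
    "\<And>ys. length ys = 5 \<Longrightarrow> recf_eval P ys (fst (prod_decode (snd (prod_decode (M ys)))))"
    "\<And>ys. length ys = 5 \<Longrightarrow> recf_eval Q ys (snd (prod_decode (snd (prod_decode (M ys)))))"
    using total_recursive_computable[OF rec(1)] total_recursive_computable[OF rec(2)]
    unfolding total_recursive_def by blast
  show "\<exists>P Q. \<forall>a b f p d c u v.
          finitary a \<and> finitary b \<and> f \<in> Perm_CF
          \<and> program_for p f \<and> rel_decider d (cycle_rel f) \<and> set_decider c (CF f)
          \<and> eta_index u a \<and> eta_index v b
          \<longrightarrow> (\<exists>d' c'.
                recf_eval P [recf_code p, recf_code d, recf_code c, u, v] (recf_code d')
              \<and> recf_eval Q [recf_code p, recf_code d, recf_code c, u, v] (recf_code c')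
              \<and> rel_decider d' (cycle_rel (a \<circ> f \<circ> b))
              \<and> set_decider c' (CF (a \<circ> f \<circ> b)))"
  proof (rule exI[of _ P], rule exI[of _ Q], intro allI impI)
    fix a b f p d c u v
    assume *: "finitary a \<and> finitary b \<and> f \<in> Perm_CF
          \<and> program_for p f \<and> rel_decider d (cycle_rel f) \<and> set_decider c (CF f)
          \<and> eta_index u a \<and> eta_index v b"
    let ?ys = "[recf_code p, recf_code d, recf_code c, u, v]"
    have "represents (prod_encode (recf_code p, prod_encode (recf_code d, recf_code c))) f"
      using * unfolding represents_def Perm_CF_def Perm_def rec_perms_def by blast
    then have "represents (M ?ys) (a \<circ> f \<circ> b)" using M(2) * by blast
    then obtain p' d' c' where
      "M ?ys = prod_encode (recf_code p', prod_encode (recf_code d', recf_code c'))"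
      "rel_decider d' (cycle_rel (a \<circ> f \<circ> b))" "set_decider c' (CF (a \<circ> f \<circ> b))"
      unfolding represents_def by blast
    moreover have "length ?ys = 5" by simp
    ultimately show "\<exists>d' c'. recf_eval P ?ys (recf_code d') \<and> recf_eval Q ?ys (recf_code c')
        \<and> rel_decider d' (cycle_rel (a \<circ> f \<circ> b)) \<and> set_decider c' (CF (a \<circ> f \<circ> b))"
      using PQ[of ?ys] by (metis fst_conv snd_conv prod_encode_inverse)
  qed
qed

end
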